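(* Let $\gamma\in(0,1]$, $\beta=\frac{2}{2-\gamma}$ and $c_\beta:=(2/\beta^2)^{\beta/2}$. Then for every $c\in\mathbb{R}$ there are exactly two admissible profiles $\phi_c^+,\phi_c^-$ with speed $c$ such that: (a) $\phi_c^+=0$ in $(-\infty,0]$, $(\phi_c^+)'>0$ in $(0,\infty)$; this profile satisfies $\phi_c^+(\xi)\to\infty$ as $\xi\to\infty$, and: if $c=0$, $\phi_0^+(\xi)=c_\beta\xi_+^\beta$; if $c>0$, $\phi_c^+(\xi)\sim\big(\frac{2\gamma}{\beta c}\xi\big)^{\beta/2}$ as $\xi\to\infty$; if $c<0$, $\phi_c^+(\xi)\sim k e^{-c\xi}$ as $\xi\to+\infty$ for some constant $k>0$; (b) $\phi_c^-=0$ in $[0,\infty)$, $(\phi_c^-)'<0$ in $(-\infty,0)$; this profile satisfies $\phi_c^-(\xi)\to\infty$ as $\xi\to-\infty$, and: if $c=0$, $\phi_0^-(\xi)=c_\beta(-\xi)_+^\beta$; if $c>0$, $\phi_c^-(\xi)\sim k e^{-c\xi}$ as $\xi\to-\infty$ for some constant $k>0$; if $c<0$, $\phi_c^-(\xi)\sim\big(\frac{2\gamma}{\beta|c|}|\xi|\big)^{\beta/2}$ as $\xi\to-\infty$. Furthermore, for every admissible profile $\psi_c$ with speed $c$ there are $a,b\in\{0,1\}$ with $a^2+b^2\ne0$ and $\xi_\pm\in\mathbb{R}$ with $\xi_-\le\xi_+$ such that $\psi_c(\xi)=a\,\phi_c^+(\xi-\xi_+)+b\,\phi_c^-(\xi-\xi_-)$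 for all $\xi\in\mathbb{R}$.
   Context: Given $c\in\mathbb{R}$, an admissible profile with speed $c$ is a continuous function $\phi:\mathbb{R}\to[0,\infty)$ which is neither identically zero nor everywhere positive, is $C^2$ on the open set $\{\phi>0\}$, satisfies $c\phi'+\phi''=\gamma\phi^{\gamma-1}$ in $\{\phi>0\}$, and satisfies the free boundary condition $\lim_{\xi\to\xi_0,\ \xi\in\{\phi>0\}}|(\phi^{1/\beta})'(\xi)|=\frac{\sqrt2}{\beta}$ for every $\xi_0\in\partial\{\phi>0\}$. (These correspond to traveling waves $u(x,t)=\phi(e\cdot x-ct)$.) $\xi_+=\max\{\xi,0\}$; $f\sim g$ means $f/g\to1$. *)

theory Defs
  imports "HOL-Analysis.Analysis" "HOL-Library.Landau_Symbols"
begin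

definition beta :: "real \<Rightarrow> real" where
  "beta \<gamma> = 2 / (2 - \<gamma>)"

definition c_beta :: "real \<Rightarrow> real" where
  "c_beta \<gamma> = (2 / (beta \<gamma>)\<^sup>2) powr (beta \<gamma> / 2)"

definition admissible :: "real \<Rightarrow> real \<Rightarrow> (real \<Rightarrow> real) \<Rightarrow> bool" where
  "admissible \<gamma> c \<phi> \<longleftrightarrow>
     continuous_on UNIV \<phi> \<and>
     (\<forall>x. \<phi> x \<ge> 0) \<and>
     \<not> (\<forall>x. \<phi> x = 0) \<and>
     \<not> (\<forall>x. \<phi> x > 0) \<and>
     (\<forall>x\<in>{y. \<phi> y > 0}.
        \<phi> differentiable (at x) \<and> deriv \<phi> differentiable (at x) \<and>
        isCont (deriv (deriv \<phi>)) x \<and>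
        c * deriv \<phi> x + deriv (deriv \<phi>) x = \<gamma> * \<phi> x powr (\<gamma> - 1)) \<and>
     (\<forall>x0\<in>frontier {y. \<phi> y > 0}.
        ((\<lambda>x. \<bar>deriv (\<lambda>t. \<phi> t powr (1 / beta \<gamma>)) x\<bar>) \<longlongrightarrow> sqrt 2 / beta \<gamma>)
          (at x0 within {y. \<phi> y > 0}))"

end

theory Submission
  imports Defs
begin

text \<open>
  Write $\beta = 2/(2-\gamma)$. A profile is convex at its critical points, so it has no bump between two
  zeros, and its positivity set consists of rays; by reflection $(\xi,c)\mapsto(-\xi,-c)$ one may
  look at $(0,\infty)$. There $(e^{c\xi}\phi')' = \gamma e^{c\xi}\phi^{\gamma-1}$, so $\phi$ is a fixed point
  of an integral operator that is antitone and homogeneous of degree $\gamma-1$. It therefore contracts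
  the metric $\sup_{(0,R]}|\ln\phi_1-\ln\phi_2|$ by the factor $1-\gamma<1$, for every $R$ at once, on the
  functions comparable with $\xi^\beta$; this gives existence and uniqueness. The free boundary condition
  is equivalent to this comparability through the energy $\phi'^2/2-\phi^\gamma$. The asymptotics at infinity
  follow from l'Hopital's rule applied to $\phi/e^{-c\xi}$ if $c<0$, and to
  $e^{c\xi}\phi^{1-\gamma}\phi'/e^{c\xi}$ and then $\phi^{2-\gamma}/\xi$ if $c>0$.
\<close>

section \<open>Functions vanishing at the left end of a half-line\<close>

text \<open>For \<gamma> < 1 the source \<gamma> phi^(\<gamma>-1) blows up at the free boundary, so
  the data phi = phi' = 0 there are out of reach of the Lipschitz theory of initial value problems.
  On a logarithmic scale the singular exponent becomes the remedy: its modulus 1-\<gamma> is the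
  contraction constant. The solution at x depends only on the source on (0,x], so the estimate does
  not deteriorate with R and the profile is global without a continuation argument. The exponent
  beta is forced by beta(\<gamma>-1) = beta-2: it is the one power that two integrations of the
  source reproduce. On bounded intervals the weight e^(c xi) costs only constants, so the sign of c
  matters only at infinity. For c > 0 the second derivative becomes negligible and c phi' = \<gamma>
  phi^(\<gamma>-1) dictates the growth; for c < 0 the weight is integrable, the flux e^(c xi) phi'
  has a finite positive limit and phi grows exponentially. The constant c_beta equals (sqrt 2 /
  beta)^beta: the free boundary condition prescribes the slope sqrt 2 / beta of
  phi^(1/beta).\<close>

lemma nonneg_of_deriv_nonneg_at_right:
  fixes D D' :: "real \<Rightarrow> real"
  assumes deriv: "\<And>x. 0 < x \<Longrightarrow> (D has_real_derivative D' x) (at x)"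
    and nonneg: "\<And>x. 0 < x \<Longrightarrow> x \<le> R \<Longrightarrow> 0 \<le> D' x"
    and lim: "(D \<longlongrightarrow> 0) (at_right 0)"
    and x: "0 < x" "x \<le> R"
  shows "0 \<le> D x"
proof (rule tendsto_upperbound[OF lim])
  show "\<forall>\<^sub>F y in at_right 0. D y \<le> D x"
    unfolding eventually_at_right_field
  proof (intro exI[of _ x] conjI allI impI)
    fix y assume y: "0 < y" "y < x"
    show "D y \<le> D x"
    proof (rule DERIV_nonneg_imp_nondecreasing[of y x D])
      show "y \<le> x" using y by simp
      fix z assume "y \<le> z" "z \<le> x"
      then show "\<exists>d. (D has_real_derivative d) (at z) \<and> 0 \<le> d"
        using deriv nonneg x y by (meson dual_order.trans less_le_trans)
    qed
  qed (use x in auto)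
qed simp

text \<open>This is how inequalities get integrated throughout. Limits at 0 from the right replace
  values at 0, because the functions compared later are constrained only for x > 0.\<close>

lemma le_of_deriv_le_at_right:
  fixes F G F' G' :: "real \<Rightarrow> real"
  assumes F: "\<And>x. 0 < x \<Longrightarrow> (F has_real_derivative F' x) (at x)" "(F \<longlongrightarrow> 0) (at_right 0)"
    and G: "\<And>x. 0 < x \<Longrightarrow> (G has_real_derivative G' x) (at x)" "(G \<longlongrightarrow> 0) (at_right 0)"
    and le: "\<And>x. 0 < x \<Longrightarrow> x \<le> R \<Longrightarrow> F' x \<le> G' x"
    and x: "0 < x" "x \<le> R"
  shows "F x \<le> G x"
proof -
  have "0 \<le> (\<lambda>x. G x - F x) x"
    by (rule nonneg_of_deriv_nonneg_at_right[where D' = "\<lambda>x. G' x - F' x" and R = R])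
      (use F G le x in \<open>auto intro!: derivative_eq_intros tendsto_eq_intros\<close>)
  then show ?thesis by simp
qed

lemma has_real_derivative_cong_at_right:
  fixes f g :: "real \<Rightarrow> real"
  assumes "(f has_real_derivative d) (at x)" "\<And>y. a < y \<Longrightarrow> f y = g y" "a < x"
  shows "(g has_real_derivative d) (at x)"
  by (rule has_field_derivative_transform_within_open[OF assms(1), of "{a<..}"]) (use assms in auto)

lemma tendsto_powr_at_right_0:
  assumes "0 < (a::real)"
  shows "((\<lambda>x. x powr a) \<longlongrightarrow> 0) (at_right 0)"
proof -
  have "((\<lambda>x::real. x powr a) \<longlongrightarrow> 0 powr a) (at_right 0)"
    by (rule tendsto_powr')
      (use assms in \<open>auto intro!: tendsto_intros simp: eventually_at_filter\<close>)
  then show ?thesis by simp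
qed

lemma has_real_derivative_powr_const:
  assumes "0 < (x::real)" "d = C * (a * x powr (a - 1))"
  shows "((\<lambda>x. C * x powr a) has_real_derivative d) (at x)"
  using assms by (auto intro!: derivative_eq_intros simp: powr_diff field_simps)

text \<open>For \<gamma> < 1 the integrand to which this is applied is only bounded by a negative
  power and may blow up at 0. Measurability on the half-open interval together with an integrable
  majorant takes the place of continuity on the closed one.\<close>

lemma integrable_on_of_powr_bound:
  fixes h :: "real \<Rightarrow> real"
  assumes cont: "continuous_on {0<..} h" and a: "-1 < a"
    and bnd: "\<And>s. 0 < s \<Longrightarrow> s \<le> R \<Longrightarrow> \<bar>h s\<bar> \<le> C * s powr a"
    and R: "0 < R"
  shows "h integrable_on {0..R}"
proof -
  have "(\<lambda>x. C * x powr a) integrable_on {0..R}"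
    using has_integral_powr_from_0[OF a, of R] R integrable_on_cmult_left by fastforce
  then have dom: "(\<lambda>x. C * x powr a) integrable_on {0<..R}"
    by (rule integrable_spike_set) (auto intro: negligible_subset[of "{0}"])
  have "h integrable_on {0<..R}"
  proof (rule measurable_bounded_by_integrable_imp_integrable[OF _ dom])
    show "h \<in> borel_measurable (lebesgue_on {0<..R})"
      by (rule continuous_imp_measurable_on_sets_lebesgue[OF continuous_on_subset[OF cont]]) auto
  qed (use bnd in auto)
  then show ?thesis
    by (rule integrable_spike_set) (auto intro: negligible_subset[of "{0}"])
qed

text \<open>Integrability up to 0 makes the indefinite integral continuous there, so it tends to 0.
  The two uses are the flux, with exponent beta - 2 > -1, and then the bounded function
  \<open>g'\<close>, with exponent 0.\<close>

lemma antiderivative_vanishing_at_right_0: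
  fixes h :: "real \<Rightarrow> real"
  assumes cont: "continuous_on {0<..} h" and a: "-1 < a"
    and bnd: "\<And>R. 0 < R \<Longrightarrow> \<exists>C. \<forall>s. 0 < s \<and> s \<le> R \<longrightarrow> \<bar>h s\<bar> \<le> C * s powr a"
  obtains H where "\<And>x. 0 < x \<Longrightarrow> (H has_real_derivative h x) (at x)" "(H \<longlongrightarrow> 0) (at_right 0)"
proof
  define H where "H = (\<lambda>x. integral {0..x} h)"
  have int: "h integrable_on {0..R}" if "0 < R" for R
    using bnd[OF that] integrable_on_of_powr_bound[OF cont a _ that] by blast
  show "(H has_real_derivative h x) (at x)" if x: "0 < x" for x
  proof -
    have *: "continuous (at x) h"
      using cont x by (metis continuous_on_eq_continuous_at greaterThan_iff open_greaterThan)
    have "(H has_vector_derivative h x) (at x within ({0..x+1} - {}))"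
      unfolding H_def
      by (rule integral_has_vector_derivative_continuous_at)
        (use int[of "x+1"] x * in \<open>auto intro: continuous_at_imp_continuous_at_within\<close>)
    moreover have "at x within {0..x+1} = at x"
      using x by (intro at_within_interior) auto
    ultimately show ?thesis
      by (simp add: has_real_derivative_iff_has_vector_derivative)
  qed
  have "continuous_on {0..1} H"
    unfolding H_def by (rule indefinite_integral_continuous_1) (simp add: int)
  then have "(H \<longlongrightarrow> H 0) (at 0 within {0..1})"
    by (simp add: continuous_on)
  then have "(H \<longlongrightarrow> H 0) (at_right 0)"
    by (simp add: at_within_Icc_at_right)
  then show "(H \<longlongrightarrow> 0) (at_right 0)"
    by (simp add: H_def)
qed

section \<open>The equation with a given source\<close>

lemma beta_facts:
  assumes "0 < \<gamma>" "\<gamma> \<le> 1"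
  shows "1 < beta \<gamma>" "beta \<gamma> \<le> 2" "beta \<gamma> * (\<gamma> - 1) = beta \<gamma> - 2"
    "beta \<gamma> * \<gamma> = 2 * beta \<gamma> - 2" "1 / beta \<gamma> = 1 - \<gamma> / 2"
  using assms by (auto simp: beta_def field_simps)

text \<open>The source \<open>f\<close> is decoupled from the unknown \<open>g\<close>: profiles are the fixed points \<open>g = f\<close>.\<close>

definition source_solution :: "real \<Rightarrow> real \<Rightarrow> (real \<Rightarrow> real) \<Rightarrow> (real \<Rightarrow> real) \<Rightarrow> (real \<Rightarrow> real) \<Rightarrow> bool" where
  "source_solution \<gamma> c f g g' \<longleftrightarrow>
     (\<forall>x>0. (g has_real_derivative g' x) (at x) \<and>
            (g' has_real_derivative \<gamma> * f x powr (\<gamma> - 1) - c * g' x) (at x)) \<and>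
     (g \<longlongrightarrow> 0) (at_right 0) \<and> (g' \<longlongrightarrow> 0) (at_right 0)"

text \<open>The constants depend on \<open>R\<close> because a profile with c \<noteq> 0 does not
  grow like x^beta at infinity. On this class the logarithmic distance is finite on every (0,R],
  though possibly not on the whole half-line.\<close>

definition power_like :: "real \<Rightarrow> (real \<Rightarrow> real) \<Rightarrow> bool" where
  "power_like b f \<longleftrightarrow> continuous_on {0<..} f \<and>
     (\<forall>R>0. \<exists>m>0. \<exists>M>0. \<forall>x. 0 < x \<and> x \<le> R \<longrightarrow> m * x powr b \<le> f x \<and> f x \<le> M * x powr b)"

lemma power_likeD:
  assumes "power_like b f" "0 < R"
  obtains m M where "0 < m" "0 < M"
    "\<And>x. 0 < x \<Longrightarrow> x \<le> R \<Longrightarrow> m * x powr b \<le> f x"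
    "\<And>x. 0 < x \<Longrightarrow> x \<le> R \<Longrightarrow> f x \<le> M * x powr b"
proof -
  from assms obtain m M where "0 < m" "0 < M"
    "\<forall>x. 0 < x \<and> x \<le> R \<longrightarrow> m * x powr b \<le> f x \<and> f x \<le> M * x powr b"
    unfolding power_like_def by blast
  then show ?thesis by (intro that[of m M]) auto
qed

lemma power_like_pos:
  assumes "power_like b f" "0 < x"
  shows "0 < f x"
proof -
  obtain m M where "0 < m" "m * x powr b \<le> f x"
    using power_likeD[OF assms] assms(2) by (metis order_refl)
  moreover have "0 < m * x powr b" using \<open>0 < m\<close> assms(2) by simp
  ultimately show ?thesis by linarith
qed

text \<open>Both logarithms differ from b ln x by a bounded amount, and b ln x cancels in the
  difference. This supplies the finite initial distance that the contraction then shrinks.\<close>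

lemma power_like_ln_diff_bounded:
  assumes "power_like b f" "power_like b g" "0 < R"
  obtains a where "0 \<le> a" "\<And>x. 0 < x \<Longrightarrow> x \<le> R \<Longrightarrow> \<bar>ln (f x) - ln (g x)\<bar> \<le> a"
proof -
  obtain m1 M1 where 1: "0 < m1" "0 < M1"
    "\<And>x. 0 < x \<Longrightarrow> x \<le> R \<Longrightarrow> m1 * x powr b \<le> f x"
    "\<And>x. 0 < x \<Longrightarrow> x \<le> R \<Longrightarrow> f x \<le> M1 * x powr b"
    using power_likeD[OF assms(1,3)] by metis
  obtain m2 M2 where 2: "0 < m2" "0 < M2"
    "\<And>x. 0 < x \<Longrightarrow> x \<le> R \<Longrightarrow> m2 * x powr b \<le> g x"
    "\<And>x. 0 < x \<Longrightarrow> x \<le> R \<Longrightarrow> g x \<le> M2 * x powr b"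
    using power_likeD[OF assms(2,3)] by metis
  have "\<bar>ln (f x) - ln (g x)\<bar> \<le> \<bar>ln m1\<bar> + \<bar>ln M1\<bar> + \<bar>ln m2\<bar> + \<bar>ln M2\<bar>" if x: "0 < x" "x \<le> R" for x
  proof -
    have p: "0 < f x" "0 < g x"
      using power_like_pos assms(1,2) x by auto
    have "ln (m1 * x powr b) \<le> ln (f x)" "ln (f x) \<le> ln (M1 * x powr b)"
      "ln (m2 * x powr b) \<le> ln (g x)" "ln (g x) \<le> ln (M2 * x powr b)"
      using 1 2 x p by (auto intro!: ln_mono)
    then show ?thesis
      using 1 2 x by (simp add: ln_mult ln_powr)
  qed
  then show ?thesis by (intro that[of "\<bar>ln m1\<bar> + \<bar>ln M1\<bar> + \<bar>ln m2\<bar> + \<bar>ln M2\<bar>"]) auto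
qed

lemma power_like_powr: "power_like b (\<lambda>x. x powr b)"
  unfolding power_like_def
  by (auto intro!: continuous_intros exI[of _ 1])

text \<open>The integrating factor e^(cx) absorbs the first-order term. The derivative of the flux
  is then a positive multiple of the source term, so sources can be compared whatever the sign of
  c.\<close>

lemma source_solution_flux:
  assumes "source_solution \<gamma> c f g g'"
  shows "\<And>x. 0 < x \<Longrightarrow> ((\<lambda>x. exp (c * x) * g' x) has_real_derivative
            \<gamma> * exp (c * x) * f x powr (\<gamma> - 1)) (at x)"
    and "((\<lambda>x. exp (c * x) * g' x) \<longlongrightarrow> 0) (at_right 0)"
  using assms unfolding source_solution_def
  by (auto intro!: derivative_eq_intros tendsto_eq_intros simp: algebra_simps)

text \<open>Since \<gamma> - 1 \<le> 0, an upper bound for \<open>f1\<close> is a lower bound for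
  its source term, and the factor e^a comes out as e^((\<gamma>-1)a). Two integrations from 0, first
  of the flux and then of the derivative, preserve the inequality.\<close>

lemma source_solution_antitone:
  assumes \<gamma>: "0 < \<gamma>" "\<gamma> \<le> 1"
    and 1: "source_solution \<gamma> c f1 g1 g1'" and 2: "source_solution \<gamma> c f2 g2 g2'"
    and pos: "\<And>x. 0 < x \<Longrightarrow> 0 < f1 x" "\<And>x. 0 < x \<Longrightarrow> 0 < f2 x"
    and le: "\<And>x. 0 < x \<Longrightarrow> x \<le> R \<Longrightarrow> f1 x \<le> exp a * f2 x"
    and x: "0 < x" "x \<le> R"
  shows "g2 x \<le> exp ((1 - \<gamma>) * a) * g1 x"
proof -
  let ?k = "exp ((1 - \<gamma>) * a)"
  have *: "f2 y powr (\<gamma> - 1) \<le> ?k * f1 y powr (\<gamma> - 1)" if y: "0 < y" "y \<le> R" for y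
  proof -
    have "(exp a * f2 y) powr (\<gamma> - 1) \<le> f1 y powr (\<gamma> - 1)"
      using le[OF y] pos y \<gamma> by (intro powr_mono2') auto
    moreover have "(exp a * f2 y) powr (\<gamma> - 1) = exp ((\<gamma> - 1) * a) * f2 y powr (\<gamma> - 1)"
      using pos y by (simp add: powr_mult exp_powr_real mult.commute)
    ultimately have "?k * (exp ((\<gamma> - 1) * a) * f2 y powr (\<gamma> - 1)) \<le> ?k * f1 y powr (\<gamma> - 1)"
      by simp
    moreover have "?k * exp ((\<gamma> - 1) * a) = 1"
      by (simp flip: exp_add add: algebra_simps)
    ultimately show ?thesis by (simp flip: mult.assoc)
  qed
  have flux: "exp (c * y) * g2' y \<le> ?k * (exp (c * y) * g1' y)" if y: "0 < y" "y \<le> R" for y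
  proof (rule le_of_deriv_le_at_right[where R = R and
        F = "\<lambda>y. exp (c * y) * g2' y" and G = "\<lambda>y. ?k * (exp (c * y) * g1' y)" and
        F' = "\<lambda>y. \<gamma> * exp (c * y) * f2 y powr (\<gamma> - 1)" and
        G' = "\<lambda>y. ?k * (\<gamma> * exp (c * y) * f1 y powr (\<gamma> - 1))"])
    show "((\<lambda>y. exp (c * y) * g2' y) \<longlongrightarrow> 0) (at_right 0)"
      using source_solution_flux[OF 2] by blast
    show "((\<lambda>y. ?k * (exp (c * y) * g1' y)) \<longlongrightarrow> 0) (at_right 0)"
      using tendsto_mult_right_zero[OF source_solution_flux(2)[OF 1]] .
    show "\<gamma> * exp (c * z) * f2 z powr (\<gamma> - 1) \<le> ?k * (\<gamma> * exp (c * z) * f1 z powr (\<gamma> - 1))"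
      if z: "0 < z" "z \<le> R" for z
      using mult_left_mono[OF *[OF z], of "\<gamma> * exp (c * z)"] \<gamma> by (simp add: algebra_simps)
  qed (use source_solution_flux(1)[OF 1] source_solution_flux(1)[OF 2] y in
        \<open>auto intro!: DERIV_cmult\<close>)
  show ?thesis
  proof (rule le_of_deriv_le_at_right[where R = R and F = g2 and G = "\<lambda>y. ?k * g1 y" and
        F' = g2' and G' = "\<lambda>y. ?k * g1' y"])
    show "g2' y \<le> ?k * g1' y" if y: "0 < y" "y \<le> R" for y
      using flux[OF y] by (simp add: mult.left_commute)
    show "((\<lambda>y. ?k * g1 y) \<longlongrightarrow> 0) (at_right 0)"
      using 1 unfolding source_solution_def by (auto intro: tendsto_mult_right_zero)
  qed (use 1 2 x in \<open>auto simp: source_solution_def intro!: DERIV_cmult\<close>)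
qed

text \<open>The solution operator is a contraction with factor $1-\gamma<1$ for Thompson's part metric.\<close>

lemma source_solution_ln_contraction:
  assumes \<gamma>: "0 < \<gamma>" "\<gamma> \<le> 1"
    and 1: "source_solution \<gamma> c f1 g1 g1'" and 2: "source_solution \<gamma> c f2 g2 g2'"
    and pos: "\<And>x. 0 < x \<Longrightarrow> 0 < f1 x" "\<And>x. 0 < x \<Longrightarrow> 0 < f2 x"
      "\<And>x. 0 < x \<Longrightarrow> 0 < g1 x" "\<And>x. 0 < x \<Longrightarrow> 0 < g2 x"
    and le: "\<And>x. 0 < x \<Longrightarrow> x \<le> R \<Longrightarrow> \<bar>ln (f1 x) - ln (f2 x)\<bar> \<le> a"
    and x: "0 < x" "x \<le> R"
  shows "\<bar>ln (g1 x) - ln (g2 x)\<bar> \<le> (1 - \<gamma>) * a"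
proof -
  have exp_iff: "u \<le> exp d * v \<longleftrightarrow> ln u - ln v \<le> d" if "0 < u" "0 < v" for u v d :: real
  proof -
    have "u \<le> exp d * v \<longleftrightarrow> ln u \<le> ln (exp d * v)" using that by (subst ln_le_cancel_iff) auto
    then show ?thesis using that by (simp add: ln_mult algebra_simps)
  qed
  have "f1 y \<le> exp a * f2 y" "f2 y \<le> exp a * f1 y" if "0 < y" "y \<le> R" for y
    using le[OF that] pos that by (auto simp: exp_iff)
  then have "g2 x \<le> exp ((1 - \<gamma>) * a) * g1 x" "g1 x \<le> exp ((1 - \<gamma>) * a) * g2 x"
    using source_solution_antitone[OF \<gamma> 1 2 pos(1,2) _ x] source_solution_antitone[OF \<gamma> 2 1 pos(2,1) _ x]
    by blast+
  then show ?thesis using pos x by (auto simp: exp_iff abs_le_iff)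
qed

text \<open>By beta(\<gamma>-1) = beta-2 the source term is comparable with x^(beta-2), which one
  integration turns into x^(beta-1). On (0,R] the weight lies between \<open>1 / ?E\<close> and
  \<open>?E\<close>.\<close>

lemma source_solution_power_bounds:
  assumes \<gamma>: "0 < \<gamma>" "\<gamma> \<le> 1" and f: "power_like (beta \<gamma>) f"
    and sol: "source_solution \<gamma> c f g g'" and R: "0 < R"
  obtains m M where "0 < m" "0 < M"
    "\<And>x. 0 < x \<Longrightarrow> x \<le> R \<Longrightarrow> m * x powr (beta \<gamma> - 1) \<le> g' x"
    "\<And>x. 0 < x \<Longrightarrow> x \<le> R \<Longrightarrow> g' x \<le> M * x powr (beta \<gamma> - 1)"
proof -
  let ?b = "beta \<gamma>" and ?E = "exp (\<bar>c\<bar> * R)"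
  note b = beta_facts[OF \<gamma>]
  obtain m M where mM: "0 < m" "0 < M"
    "\<And>x. 0 < x \<Longrightarrow> x \<le> R \<Longrightarrow> m * x powr ?b \<le> f x"
    "\<And>x. 0 < x \<Longrightarrow> x \<le> R \<Longrightarrow> f x \<le> M * x powr ?b"
    using power_likeD[OF f R] by metis
  \<comment> \<open>The exponent \<gamma> - 1 is nonpositive, so the upper constant \<open>M\<close>
    of \<open>f\<close> enters the lower constant \<open>A\<close>, and \<open>m\<close> enters
    \<open>B\<close>. The divisor beta - 1 comes from integrating x^(beta-2).\<close>
  define A B where "A = \<gamma> * M powr (\<gamma> - 1) / ?E / (?b - 1)" and "B = \<gamma> * m powr (\<gamma> - 1) * ?E / (?b - 1)"
  have AB: "0 < A" "0 < B" using \<gamma> mM b by (auto simp: A_def B_def)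
  have exp_le: "exp (c * x) \<le> ?E" "1 / ?E \<le> exp (c * x)" if "0 < x" "x \<le> R" for x
  proof -
    have "\<bar>c * x\<bar> \<le> \<bar>c\<bar> * R" using that by (simp add: abs_mult mult_left_mono)
    then have "c * x \<le> \<bar>c\<bar> * R" "- (\<bar>c\<bar> * R) \<le> c * x" by linarith+
    then show "exp (c * x) \<le> ?E" "1 / ?E \<le> exp (c * x)"
      by (simp_all add: exp_minus inverse_eq_divide flip: exp_le_cancel_iff[of "- (\<bar>c\<bar> * R)"])
  qed
  have powr_split: "(k * x powr ?b) powr (\<gamma> - 1) = k powr (\<gamma> - 1) * x powr (?b - 2)"
    if "0 < k" "0 < x" for k x
    using that b by (simp add: powr_mult powr_powr)
  have rate: "M powr (\<gamma> - 1) * x powr (?b - 2) \<le> f x powr (\<gamma> - 1)"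
    "f x powr (\<gamma> - 1) \<le> m powr (\<gamma> - 1) * x powr (?b - 2)" if x: "0 < x" "x \<le> R" for x
  proof -
    have p: "0 < f x" using power_like_pos[OF f x(1)] .
    have "(M * x powr ?b) powr (\<gamma> - 1) \<le> f x powr (\<gamma> - 1)"
      using mM x p \<gamma> by (intro powr_mono2') auto
    then show "M powr (\<gamma> - 1) * x powr (?b - 2) \<le> f x powr (\<gamma> - 1)"
      using powr_split mM x by simp
    have "f x powr (\<gamma> - 1) \<le> (m * x powr ?b) powr (\<gamma> - 1)"
      using mM x p \<gamma> by (intro powr_mono2') auto
    then show "f x powr (\<gamma> - 1) \<le> m powr (\<gamma> - 1) * x powr (?b - 2)"
      using powr_split mM x by simp
  qed
  have dpow: "((\<lambda>x. K / (?b - 1) * x powr (?b - 1)) has_real_derivative K * x powr (?b - 2)) (at x)" if "0 < x" for K x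
    by (rule has_real_derivative_powr_const[OF that]) (use b in simp)
  have lpow: "((\<lambda>x. K * x powr (?b - 1)) \<longlongrightarrow> 0) (at_right 0)" for K
    using b by (intro tendsto_mult_right_zero tendsto_powr_at_right_0) auto
  have lower: "A * x powr (?b - 1) \<le> exp (c * x) * g' x" if x: "0 < x" "x \<le> R" for x
  proof (rule le_of_deriv_le_at_right[where R = R and F = "\<lambda>x. A * x powr (?b - 1)" and
        F' = "\<lambda>x. \<gamma> * M powr (\<gamma> - 1) / ?E * x powr (?b - 2)" and
        G = "\<lambda>x. exp (c * x) * g' x" and G' = "\<lambda>x. \<gamma> * exp (c * x) * f x powr (\<gamma> - 1)"])
    show "\<gamma> * M powr (\<gamma> - 1) / ?E * y powr (?b - 2) \<le> \<gamma> * exp (c * y) * f y powr (\<gamma> - 1)"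
      if y: "0 < y" "y \<le> R" for y
    proof -
      have "(1 / ?E) * (M powr (\<gamma> - 1) * y powr (?b - 2)) \<le> exp (c * y) * f y powr (\<gamma> - 1)"
        using rate[OF y] exp_le[OF y] by (intro mult_mono) auto
      from mult_left_mono[OF this, of \<gamma>] \<gamma> show ?thesis by (simp add: algebra_simps)
    qed
    show "((\<lambda>x. A * x powr (?b - 1)) has_real_derivative \<gamma> * M powr (\<gamma> - 1) / ?E * y powr (?b - 2)) (at y)"
      if "0 < y" for y
      unfolding A_def by (rule dpow[OF that])
  qed (fact source_solution_flux[OF sol] x lpow)+
  have upper: "exp (c * x) * g' x \<le> B * x powr (?b - 1)" if x: "0 < x" "x \<le> R" for x
  proof (rule le_of_deriv_le_at_right[where R = R and G = "\<lambda>x. B * x powr (?b - 1)" and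
        G' = "\<lambda>x. \<gamma> * m powr (\<gamma> - 1) * ?E * x powr (?b - 2)" and
        F = "\<lambda>x. exp (c * x) * g' x" and F' = "\<lambda>x. \<gamma> * exp (c * x) * f x powr (\<gamma> - 1)"])
    show "\<gamma> * exp (c * y) * f y powr (\<gamma> - 1) \<le> \<gamma> * m powr (\<gamma> - 1) * ?E * y powr (?b - 2)"
      if y: "0 < y" "y \<le> R" for y
    proof -
      have "exp (c * y) * f y powr (\<gamma> - 1) \<le> ?E * (m powr (\<gamma> - 1) * y powr (?b - 2))"
        using rate[OF y] exp_le[OF y] by (intro mult_mono) auto
      from mult_left_mono[OF this, of \<gamma>] \<gamma> show ?thesis by (simp add: algebra_simps)
    qed
    show "((\<lambda>x. B * x powr (?b - 1)) has_real_derivative \<gamma> * m powr (\<gamma> - 1) * ?E * y powr (?b - 2)) (at y)"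
      if "0 < y" for y
      unfolding B_def by (rule dpow[OF that])
  qed (fact source_solution_flux[OF sol] x lpow)+
  show ?thesis
  \<comment> \<open>The bounds so far concern the flux; removing the weight to reach
    \<open>g'\<close> costs one more factor \<open>?E\<close> on each side.\<close>
  proof (rule that[of "A / ?E" "B * ?E"])
    fix x assume x: "0 < x" "x \<le> R"
    have "0 \<le> A * x powr (?b - 1)" using AB by simp
    then have g0: "0 \<le> g' x" using lower[OF x] by (smt (verit) exp_gt_zero zero_le_mult_iff)
    have "A * x powr (?b - 1) \<le> ?E * g' x"
      using lower[OF x] mult_right_mono[OF exp_le(1)[OF x] g0] by linarith
    then show "A / ?E * x powr (?b - 1) \<le> g' x"
      by (simp add: field_simps)
    have "(1 / ?E) * g' x \<le> B * x powr (?b - 1)"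
      using upper[OF x] mult_right_mono[OF exp_le(2)[OF x] g0] by linarith
    then show "g' x \<le> B * ?E * x powr (?b - 1)"
      by (simp add: field_simps)
  qed (use AB in auto)
qed

text \<open>The second integration brings the exponent from beta - 1 back to beta. The class is thus
  invariant under the solution operator, which is what allows iteration.\<close>

lemma source_solution_power_like:
  assumes \<gamma>: "0 < \<gamma>" "\<gamma> \<le> 1" and f: "power_like (beta \<gamma>) f"
    and sol: "source_solution \<gamma> c f g g'"
  shows "power_like (beta \<gamma>) g"
  unfolding power_like_def
proof (intro conjI allI impI)
  let ?b = "beta \<gamma>"
  note b = beta_facts[OF \<gamma>]
  show "continuous_on {0<..} g"
    by (rule continuous_at_imp_continuous_on)
      (use sol in \<open>auto simp: source_solution_def intro: DERIV_isCont\<close>)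
  fix R :: real assume R: "0 < R"
  obtain m M where mM: "0 < m" "0 < M"
    "\<And>x. 0 < x \<Longrightarrow> x \<le> R \<Longrightarrow> m * x powr (?b - 1) \<le> g' x"
    "\<And>x. 0 < x \<Longrightarrow> x \<le> R \<Longrightarrow> g' x \<le> M * x powr (?b - 1)"
    using source_solution_power_bounds[OF \<gamma> f sol R] by metis
  have dpow: "((\<lambda>x. K / ?b * x powr ?b) has_real_derivative K * x powr (?b - 1)) (at x)" if "0 < x" for K x
    by (rule has_real_derivative_powr_const[OF that]) (use b in simp)
  have lpow: "((\<lambda>x. K * x powr ?b) \<longlongrightarrow> 0) (at_right 0)" for K
    using b by (intro tendsto_mult_right_zero tendsto_powr_at_right_0) auto
  have g: "\<And>x. 0 < x \<Longrightarrow> (g has_real_derivative g' x) (at x)" "(g \<longlongrightarrow> 0) (at_right 0)"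
    using sol by (auto simp: source_solution_def)
  have "m / ?b * x powr ?b \<le> g x \<and> g x \<le> M / ?b * x powr ?b" if x: "0 < x" "x \<le> R" for x
    using le_of_deriv_le_at_right[OF dpow lpow g mM(3) x] le_of_deriv_le_at_right[OF g dpow lpow mM(4) x]
    by blast
  then show "\<exists>m>0. \<exists>M>0. \<forall>x. 0 < x \<and> x \<le> R \<longrightarrow> m * x powr ?b \<le> g x \<and> g x \<le> M * x powr ?b"
    using mM b by (intro exI[of _ "m / ?b"] conjI exI[of _ "M / ?b"]) auto
qed

lemma source_solution_exists:
  assumes \<gamma>: "0 < \<gamma>" "\<gamma> \<le> 1" and f: "power_like (beta \<gamma>) f"
  shows "\<exists>g g'. source_solution \<gamma> c f g g'"
proof -
  let ?b = "beta \<gamma>"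
  note b = beta_facts[OF \<gamma>]
  have fpos: "0 < f x" if "0 < x" for x using power_like_pos[OF f that] .
  have fcont: "continuous_on {0<..} f" using f by (simp add: power_like_def)
  obtain H where H: "\<And>x. 0 < x \<Longrightarrow> (H has_real_derivative \<gamma> * exp (c * x) * f x powr (\<gamma> - 1)) (at x)"
    "(H \<longlongrightarrow> 0) (at_right 0)"
  proof (rule antiderivative_vanishing_at_right_0[of "\<lambda>x. \<gamma> * exp (c * x) * f x powr (\<gamma> - 1)" "?b - 2"])
    show "continuous_on {0<..} (\<lambda>x. \<gamma> * exp (c * x) * f x powr (\<gamma> - 1))"
      using fpos by (intro continuous_intros fcont) (auto simp: less_imp_neq[THEN not_sym])
    show "-1 < ?b - 2" using b by simp
    fix R :: real assume R: "0 < R"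
    obtain m M where mM: "0 < m" "\<And>x. 0 < x \<Longrightarrow> x \<le> R \<Longrightarrow> m * x powr ?b \<le> f x"
      using power_likeD[OF f R] by metis
    have "\<bar>\<gamma> * exp (c * x) * f x powr (\<gamma> - 1)\<bar> \<le> \<gamma> * exp (\<bar>c\<bar> * R) * m powr (\<gamma> - 1) * x powr (?b - 2)"
      if x: "0 < x" "x \<le> R" for x
    proof -
      have "f x powr (\<gamma> - 1) \<le> (m * x powr ?b) powr (\<gamma> - 1)"
        using mM x fpos \<gamma> by (intro powr_mono2') auto
      moreover have "(m * x powr ?b) powr (\<gamma> - 1) = m powr (\<gamma> - 1) * x powr (?b - 2)"
        using mM x b by (simp add: powr_mult powr_powr)
      moreover have "c * x \<le> \<bar>c\<bar> * R"
        using x by (intro mult_mono) auto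
      ultimately have "exp (c * x) * f x powr (\<gamma> - 1) \<le> exp (\<bar>c\<bar> * R) * (m powr (\<gamma> - 1) * x powr (?b - 2))"
        by (intro mult_mono) auto
      from mult_left_mono[OF this, of \<gamma>] \<gamma> show ?thesis by (simp add: abs_mult algebra_simps)
    qed
    then show "\<exists>C. \<forall>s. 0 < s \<and> s \<le> R \<longrightarrow> \<bar>\<gamma> * exp (c * s) * f s powr (\<gamma> - 1)\<bar> \<le> C * s powr (?b - 2)"
      by blast
  qed blast
  define g' where "g' x = exp (- c * x) * H x" for x
  have g'd: "(g' has_real_derivative \<gamma> * f x powr (\<gamma> - 1) - c * g' x) (at x)" if "0 < x" for x
    unfolding g'_def using that
    by (auto intro!: derivative_eq_intros H(1) simp: algebra_simps simp flip: exp_add)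
  have g'l: "(g' \<longlongrightarrow> 0) (at_right 0)"
    unfolding g'_def by (auto intro!: tendsto_eq_intros H(2))
  obtain g where "\<And>x. 0 < x \<Longrightarrow> (g has_real_derivative g' x) (at x)" "(g \<longlongrightarrow> 0) (at_right 0)"
  proof (rule antiderivative_vanishing_at_right_0[of g' 0])
    show c: "continuous_on {0<..} g'"
      by (rule continuous_at_imp_continuous_on) (auto intro: DERIV_isCont g'd)
    fix R :: real assume R: "0 < R"
    \<comment> \<open>The value of \<open>g'\<close> at 0 is arbitrary. Replacing it by the limit 0
      gives a continuous function on a compact interval, hence the bound with exponent 0 for the
      second antiderivative.\<close>
    have "continuous_on {0..R} (\<lambda>x. if x = 0 then 0 else g' x)"
      unfolding continuous_on_def
    proof
      fix x assume x: "x \<in> {0..R}"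
      show "((\<lambda>x. if x = 0 then 0 else g' x) \<longlongrightarrow> (if x = 0 then 0 else g' x)) (at x within {0..R})"
      proof (cases "x = 0")
        case True
        have "((\<lambda>x. if x = 0 then 0 else g' x) \<longlongrightarrow> 0) (at_right 0)"
          by (rule Lim_transform_eventually[OF g'l]) (auto simp: eventually_at_filter)
        then show ?thesis using True R by (simp add: at_within_Icc_at_right)
      next
        case False
        then have "(g' \<longlongrightarrow> g' x) (at x)"
          using x DERIV_isCont[OF g'd[of x]] by (simp add: isCont_def)
        then have "((\<lambda>x. if x = 0 then 0 else g' x) \<longlongrightarrow> g' x) (at x)"
          by (rule Lim_transform_within_open[of _ _ _ _ "-{0}"]) (use False in auto)
        then show ?thesis using False by (auto intro: tendsto_within_subset)
      qed
    qed
    then have "bounded ((\<lambda>x. if x = 0 then 0 else g' x) ` {0..R})"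
      by (intro compact_imp_bounded compact_continuous_image) auto
    then obtain C where C: "\<forall>y\<in>(\<lambda>x. if x = 0 then 0 else g' x) ` {0..R}. norm y \<le> C"
      unfolding bounded_iff by blast
    have "\<bar>g' s\<bar> \<le> C" if "0 < s" "s \<le> R" for s
      using C[rule_format, OF imageI, of s] that by simp
    then show "\<exists>C. \<forall>s. 0 < s \<and> s \<le> R \<longrightarrow> \<bar>g' s\<bar> \<le> C * s powr 0"
      by (intro exI[of _ C]) auto
  qed auto
  then show ?thesis using g'd g'l unfolding source_solution_def by blast
qed

section \<open>Profiles on a half-line\<close>

text \<open>The last condition is the free boundary condition, since $(f^{1/\beta})' = \frac1\beta f'/f^{\gamma/2}$.\<close>

definition half_profile :: "real \<Rightarrow> real \<Rightarrow> (real \<Rightarrow> real) \<Rightarrow> (real \<Rightarrow> real) \<Rightarrow> bool" where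
  "half_profile \<gamma> c f f' \<longleftrightarrow> (\<forall>x>0. 0 < f x) \<and> source_solution \<gamma> c f f f' \<and>
     ((\<lambda>x. f' x / f x powr (\<gamma> / 2)) \<longlongrightarrow> sqrt 2) (at_right 0)"

section \<open>Behaviour at the free boundary and uniqueness\<close>

lemma eventually_at_right_0_pos: "(\<And>x::real. 0 < x \<Longrightarrow> P x) \<Longrightarrow> eventually P (at_right 0)"
  by (auto simp: eventually_at_filter)

lemma has_real_derivative_root_beta:
  assumes \<gamma>: "0 < \<gamma>" "\<gamma> \<le> 1" and f: "(f has_real_derivative d) (at x)" "0 < f x"
  shows "((\<lambda>t. f t powr (1 / beta \<gamma>)) has_real_derivative 1 / beta \<gamma> * (d / f x powr (\<gamma> / 2))) (at x)"
proof -
  note b = beta_facts[OF \<gamma>]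
  have "((\<lambda>t. f t powr (1 / beta \<gamma>)) has_real_derivative 1 / beta \<gamma> * f x powr (1 / beta \<gamma> - 1) * d) (at x)"
    by (rule DERIV_fun_powr[OF f(1) f(2), of "1 / beta \<gamma>", simplified of_nat_1])
  moreover have "f x powr (1 / beta \<gamma> - 1) = 1 / f x powr (\<gamma> / 2)"
    using b(5) by (simp add: powr_minus inverse_eq_divide)
  ultimately show ?thesis by simp
qed

lemma c_beta_pos:
  assumes "0 < \<gamma>" "\<gamma> \<le> 1"
  shows "0 < c_beta \<gamma>"
  using beta_facts[OF assms] by (simp add: c_beta_def)

text \<open>The derivative of \<open>f powr (1 / beta \<gamma>)\<close> tends to sqrt 2 / beta, so
  l'Hopital's rule gives its quotient by x the same limit. Raising to the power beta produces
  \<open>c_beta \<gamma>\<close>.\<close>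

lemma half_profile_asymp_0:
  assumes \<gamma>: "0 < \<gamma>" "\<gamma> \<le> 1" and p: "half_profile \<gamma> c f f'"
  shows "((\<lambda>x. f x / x powr beta \<gamma>) \<longlongrightarrow> c_beta \<gamma>) (at_right 0)"
proof -
  let ?b = "beta \<gamma>"
  note b = beta_facts[OF \<gamma>]
  have pos: "0 < f x" and der: "(f has_real_derivative f' x) (at x)" if "0 < x" for x
    using p that by (auto simp: half_profile_def source_solution_def)
  have "((\<lambda>x. f x powr (1 / ?b) / x) \<longlongrightarrow> 1 / ?b * sqrt 2) (at_right 0)"
  proof (rule lhopital_right_0)
    show "((\<lambda>x. f x powr (1 / ?b)) \<longlongrightarrow> 0) (at_right 0)"
    proof -
      have "((\<lambda>x. f x powr (1 / ?b)) \<longlongrightarrow> 0 powr (1 / ?b)) (at_right 0)"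
      proof (rule tendsto_powr')
        show "(f \<longlongrightarrow> 0) (at_right 0)"
          using p by (simp add: half_profile_def source_solution_def)
        have "\<forall>\<^sub>F x in at_right 0. 0 \<le> f x"
          by (rule eventually_at_right_0_pos) (simp add: pos less_imp_le)
        then show "0 \<noteq> (0::real) \<or> 0 < 1 / ?b \<and> (\<forall>\<^sub>F x in at_right 0. 0 \<le> f x)"
          using b(1) by simp
      qed auto
      then show ?thesis by simp
    qed
    show "\<forall>\<^sub>F x in at_right 0. ((\<lambda>x. f x powr (1 / ?b)) has_real_derivative 1 / ?b * (f' x / f x powr (\<gamma> / 2))) (at x)"
      by (rule eventually_at_right_0_pos) (rule has_real_derivative_root_beta[OF \<gamma> der pos])
    show "((\<lambda>x. 1 / ?b * (f' x / f x powr (\<gamma> / 2)) / 1) \<longlongrightarrow> 1 / ?b * sqrt 2) (at_right 0)"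
      unfolding div_by_1 using p by (intro tendsto_intros) (simp add: half_profile_def)
  qed (auto intro!: eventually_at_right_0_pos tendsto_intros)
  then have "((\<lambda>x. (f x powr (1 / ?b) / x) powr ?b) \<longlongrightarrow> (1 / ?b * sqrt 2) powr ?b) (at_right 0)"
    using b by (intro tendsto_powr) auto
  moreover have "(1 / ?b * sqrt 2) powr ?b = c_beta \<gamma>"
  proof -
    have "(1 / ?b * sqrt 2) = (2 / ?b\<^sup>2) powr (1 / 2)"
      using b(1) by (simp add: powr_half_sqrt real_sqrt_divide)
    then show ?thesis by (simp add: c_beta_def powr_powr)
  qed
  moreover have "\<forall>\<^sub>F x in at_right 0. (f x powr (1 / ?b) / x) powr ?b = f x / x powr ?b"
    by (rule eventually_at_right_0_pos) (use pos b(1) in \<open>simp add: powr_divide powr_powr less_imp_le\<close>)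
  ultimately show ?thesis
    by (simp add: Lim_transform_eventually)
qed

text \<open>The quotient f / x^beta extends continuously to [0,R] with the positive value
  \<open>c_beta \<gamma>\<close> at 0. Its minimum and maximum there are the required
  constants.\<close>

lemma half_profile_power_like:
  assumes \<gamma>: "0 < \<gamma>" "\<gamma> \<le> 1" and p: "half_profile \<gamma> c f f'"
  shows "power_like (beta \<gamma>) f"
  unfolding power_like_def
proof (intro conjI allI impI)
  let ?b = "beta \<gamma>"
  have pos: "0 < f x" and der: "(f has_real_derivative f' x) (at x)" if "0 < x" for x
    using p that by (auto simp: half_profile_def source_solution_def)
  show "continuous_on {0<..} f"
    by (rule continuous_at_imp_continuous_on) (auto intro: DERIV_isCont der)
  fix R :: real assume R: "0 < R"
  define H where "H x = (if x = 0 then c_beta \<gamma> else f x / x powr ?b)" for x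
  have cont: "continuous_on {0..R} H"
    unfolding continuous_on_def
  proof
    fix x assume x: "x \<in> {0..R}"
    show "(H \<longlongrightarrow> H x) (at x within {0..R})"
    proof (cases "x = 0")
      case True
      have "(H \<longlongrightarrow> c_beta \<gamma>) (at_right 0)"
        by (rule Lim_transform_eventually[OF half_profile_asymp_0[OF \<gamma> p]])
          (auto simp: eventually_at_filter H_def)
      then show ?thesis using True R by (simp add: at_within_Icc_at_right H_def)
    next
      case False
      then have x0: "0 < x" using x by simp
      have "isCont (\<lambda>x. f x / x powr ?b) x"
        using x0 DERIV_isCont[OF der[OF x0]] by (intro continuous_intros) auto
      then have "((\<lambda>x. f x / x powr ?b) \<longlongrightarrow> H x) (at x)"
        using x0 by (simp add: isCont_def H_def)
      then have "(H \<longlongrightarrow> H x) (at x)"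
        by (rule Lim_transform_within_open[of _ _ _ _ "-{0}"]) (use x0 in \<open>auto simp: H_def\<close>)
      then show ?thesis by (auto intro: tendsto_within_subset)
    qed
  qed
  obtain u where u: "u \<in> {0..R}" "\<And>y. y \<in> {0..R} \<Longrightarrow> H u \<le> H y"
    using continuous_attains_inf[OF _ _ cont] R by auto
  obtain v where v: "v \<in> {0..R}" "\<And>y. y \<in> {0..R} \<Longrightarrow> H y \<le> H v"
    using continuous_attains_sup[OF _ _ cont] R by auto
  have Hpos: "0 < H y" if "y \<in> {0..R}" for y
    using that pos c_beta_pos[OF \<gamma>] by (auto simp: H_def)
  show "\<exists>m>0. \<exists>M>0. \<forall>x. 0 < x \<and> x \<le> R \<longrightarrow> m * x powr ?b \<le> f x \<and> f x \<le> M * x powr ?b"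
  proof (rule exI[of _ "H u"], intro conjI exI[of _ "H v"] allI impI)
    fix x assume x: "0 < x \<and> x \<le> R"
    then have "H u \<le> f x / x powr ?b" "f x / x powr ?b \<le> H v"
      using u(2)[of x] v(2)[of x] by (auto simp: H_def)
    then show "H u * x powr ?b \<le> f x" "f x \<le> H v * x powr ?b"
      using x by (auto simp: field_simps)
  qed (use u v Hpos in auto)
qed

theorem half_profile_unique:
  assumes \<gamma>: "0 < \<gamma>" "\<gamma> \<le> 1" and p: "half_profile \<gamma> c f f'" and q: "half_profile \<gamma> c g g'"
    and x: "0 < x"
  shows "f x = g x"
proof -
  have pos: "0 < f y" "0 < g y" if "0 < y" for y
    using p q that by (auto simp: half_profile_def)
  obtain a where a: "0 \<le> a" "\<And>y. 0 < y \<Longrightarrow> y \<le> x \<Longrightarrow> \<bar>ln (f y) - ln (g y)\<bar> \<le> a"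
    using power_like_ln_diff_bounded[OF half_profile_power_like[OF \<gamma> p] half_profile_power_like[OF \<gamma> q] x] by metis
  \<comment> \<open>Each profile is its own source, so the contraction applies to its own
    conclusion. The induction keeps \<open>y\<close> arbitrary because every application needs the
    previous bound on all of (0,x].\<close>
  have iterate: "0 < y \<Longrightarrow> y \<le> x \<Longrightarrow> \<bar>ln (f y) - ln (g y)\<bar> \<le> (1 - \<gamma>) ^ n * a" for n y
  proof (induction n arbitrary: y)
    case (Suc n)
    have "\<bar>ln (f y) - ln (g y)\<bar> \<le> (1 - \<gamma>) * ((1 - \<gamma>) ^ n * a)"
      by (rule source_solution_ln_contraction[OF \<gamma>, where R = x and c = c and ?f1.0 = f and ?f2.0 = g])
        (use p q Suc pos in \<open>auto simp: half_profile_def\<close>)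
    then show ?case by (simp add: mult.assoc)
  qed (use a in auto)
  have bound: "\<bar>ln (f x) - ln (g x)\<bar> \<le> (1 - \<gamma>) ^ n * a" for n
    using iterate x by simp
  have "(\<lambda>n. (1 - \<gamma>) ^ n * a) \<longlonglongrightarrow> 0"
    using \<gamma> by (intro tendsto_mult_left_zero LIMSEQ_power_zero) auto
  then have "\<bar>ln (f x) - ln (g x)\<bar> \<le> 0"
    by (rule LIMSEQ_le_const) (use bound in auto)
  then show ?thesis using pos[OF x] by simp
qed

text \<open>The energy $f'^2/2-f^\gamma$ has derivative $-cf'^2$, which near 0 is negligible against $f^\gamma$.\<close>

lemma half_profileI_power_like:
  assumes \<gamma>: "0 < \<gamma>" "\<gamma> \<le> 1" and f: "power_like (beta \<gamma>) f" and sol: "source_solution \<gamma> c f f f'"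
  shows "half_profile \<gamma> c f f'"
proof -
  let ?b = "beta \<gamma>"
  note b = beta_facts[OF \<gamma>]
  have pos: "0 < f x" if "0 < x" for x using power_like_pos[OF f that] .
  have der: "(f has_real_derivative f' x) (at x)"
    "(f' has_real_derivative \<gamma> * f x powr (\<gamma> - 1) - c * f' x) (at x)" if "0 < x" for x
    using sol that by (auto simp: source_solution_def)
  have lim: "(f \<longlongrightarrow> 0) (at_right 0)" "(f' \<longlongrightarrow> 0) (at_right 0)"
    using sol by (auto simp: source_solution_def)
  obtain m where m: "0 < m" "\<And>x. 0 < x \<Longrightarrow> x \<le> 1 \<Longrightarrow> m * x powr ?b \<le> f x"
    using power_likeD[OF f zero_less_one] by metis
  obtain l M where M: "0 < l" "0 < M" "\<And>x. 0 < x \<Longrightarrow> x \<le> 1 \<Longrightarrow> l * x powr (?b - 1) \<le> f' x"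
    "\<And>x. 0 < x \<Longrightarrow> x \<le> 1 \<Longrightarrow> f' x \<le> M * x powr (?b - 1)"
    using source_solution_power_bounds[OF \<gamma> f sol zero_less_one] by metis
  have f'pos: "0 < f' x" if "0 < x" "x \<le> 1" for x
    using M(3)[OF that] M(1) that by (smt (verit) mult_pos_pos powr_gt_zero)
  define E where "E x = f' x * f' x / 2 - f x powr \<gamma>" for x
  have E_der: "(E has_real_derivative - c * (f' x * f' x)) (at x)" if x: "0 < x" for x
  proof -
    have "((\<lambda>x. f x powr \<gamma>) has_real_derivative \<gamma> * f x powr (\<gamma> - 1) * f' x) (at x)"
      using DERIV_fun_powr[OF der(1)[OF x] pos[OF x], of \<gamma>] by simp
    moreover have "((\<lambda>x. f' x * f' x / 2) has_real_derivative f' x * (\<gamma> * f x powr (\<gamma> - 1) - c * f' x)) (at x)"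
      by (auto intro!: derivative_eq_intros der[OF x])
    ultimately have "(E has_real_derivative f' x * (\<gamma> * f x powr (\<gamma> - 1) - c * f' x) -
        \<gamma> * f x powr (\<gamma> - 1) * f' x) (at x)"
      unfolding E_def by (intro DERIV_diff)
    then show ?thesis by (simp add: algebra_simps)
  qed
  have "((\<lambda>x. f x powr \<gamma>) \<longlongrightarrow> 0 powr \<gamma>) (at_right 0)"
    using \<gamma> pos by (intro tendsto_powr' lim) (auto intro!: eventually_at_right_0_pos less_imp_le)
  then have E_lim: "(E \<longlongrightarrow> 0) (at_right 0)"
    using tendsto_diff[OF tendsto_divide[OF tendsto_mult[OF lim(2) lim(2)] tendsto_const[of "2::real"]]]
    unfolding E_def by force
  define K where "K = \<bar>c\<bar> * M\<^sup>2"
  \<comment> \<open>This exponent plays two roles: it is that of the square of x^(beta-1), which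
    bounds the derivative of the energy, and by beta \<gamma> = 2 beta - 2 it is also that of
    \<open>f powr \<gamma>\<close>. Integrating the former gains a factor x, so
    \<open>E x / f x powr \<gamma>\<close> is O(x).\<close>
  define e where "e = 2 * ?b - 2"
  have e: "0 < e" using b by (simp add: e_def)
  have E'_le: "\<bar>- c * (f' x * f' x)\<bar> \<le> K * x powr e" if x: "0 < x" "x \<le> 1" for x
  proof -
    have "f' x * f' x \<le> (M * x powr (?b - 1)) * (M * x powr (?b - 1))"
      using M(4)[OF x] f'pos[OF x] by (intro mult_mono) auto
    also have "\<dots> = M\<^sup>2 * x powr e"
      using x by (simp add: power2_eq_square e_def mult.left_commute flip: powr_add)
    finally show ?thesis
      unfolding K_def by (auto simp: abs_mult mult.assoc intro!: mult_left_mono)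
  qed
  have E'_bounds: "- c * (f' x * f' x) \<le> K * x powr e" "- K * x powr e \<le> - c * (f' x * f' x)"
    if "0 < x" "x \<le> 1" for x
    using E'_le[OF that] unfolding abs_le_iff by simp_all
  have dpow: "((\<lambda>x. k / (e + 1) * x powr (e + 1)) has_real_derivative k * x powr e) (at x)" if "0 < x" for k x
    by (rule has_real_derivative_powr_const[OF that]) (use e in simp)
  have lpow: "((\<lambda>x. k * x powr (e + 1)) \<longlongrightarrow> 0) (at_right 0)" for k
    using e by (intro tendsto_mult_right_zero tendsto_powr_at_right_0) auto
  have E_le: "\<bar>E x\<bar> \<le> K / (e + 1) * x powr (e + 1)" if x: "0 < x" "x \<le> 1" for x
  proof -
    have "E x \<le> K / (e + 1) * x powr (e + 1)"
      by (rule le_of_deriv_le_at_right[OF E_der E_lim dpow lpow E'_bounds(1) x])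
    moreover have "- K / (e + 1) * x powr (e + 1) \<le> E x"
      by (rule le_of_deriv_le_at_right[OF dpow lpow E_der E_lim E'_bounds(2) x])
    ultimately show ?thesis by (simp add: abs_le_iff)
  qed
  have ratio: "\<bar>E x / f x powr \<gamma>\<bar> \<le> K / (e + 1) / m powr \<gamma> * x" if x: "0 < x" "x \<le> 1" for x
  proof -
    have "(m * x powr ?b) powr \<gamma> \<le> f x powr \<gamma>"
      using m x \<gamma> by (intro powr_mono2) auto
    then have le: "m powr \<gamma> * x powr e \<le> f x powr \<gamma>"
      using m x b by (simp add: powr_mult powr_powr e_def)
    have "\<bar>E x / f x powr \<gamma>\<bar> = \<bar>E x\<bar> / f x powr \<gamma>" by simp
    also have "\<dots> \<le> (K / (e + 1) * x powr (e + 1)) / (m powr \<gamma> * x powr e)"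
      using E_le[OF x] le m x e by (intro frac_le) (auto simp: K_def)
    also have "\<dots> = K / (e + 1) / m powr \<gamma> * x"
      using x by (simp add: powr_add)
    finally show ?thesis .
  qed
  have "((\<lambda>x. E x / f x powr \<gamma>) \<longlongrightarrow> 0) (at_right 0)"
  proof (rule Lim_null_comparison)
    show "\<forall>\<^sub>F x in at_right 0. norm (E x / f x powr \<gamma>) \<le> K / (e + 1) / m powr \<gamma> * x"
      unfolding eventually_at_right_field using ratio by (intro exI[of _ 1]) auto
    show "((\<lambda>x. K / (e + 1) / m powr \<gamma> * x) \<longlongrightarrow> 0) (at_right 0)"
      by (intro tendsto_mult_right_zero tendsto_intros)
  qed
  then have "((\<lambda>x. sqrt (2 + 2 * (E x / f x powr \<gamma>))) \<longlongrightarrow> sqrt 2) (at_right 0)"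
    using tendsto_real_sqrt[OF tendsto_add[OF tendsto_const[of 2] tendsto_mult[OF tendsto_const[of 2]]]]
    by force
  moreover have "\<forall>\<^sub>F x in at_right 0. sqrt (2 + 2 * (E x / f x powr \<gamma>)) = f' x / f x powr (\<gamma> / 2)"
    unfolding eventually_at_right_field
  proof (intro exI[of _ 1] conjI allI impI)
    fix x :: real assume x: "0 < x" "x < 1"
    have "f x powr (\<gamma> / 2) * f x powr (\<gamma> / 2) = f x powr \<gamma>"
      by (simp flip: powr_add)
    then have "2 + 2 * (E x / f x powr \<gamma>) = (f' x / f x powr (\<gamma> / 2))\<^sup>2"
      using pos[OF x(1)] by (simp add: E_def power2_eq_square field_simps)
    \<comment> \<open>Positivity of \<open>f'\<close> on (0,1] selects the positive square
      root.\<close>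
    then show "sqrt (2 + 2 * (E x / f x powr \<gamma>)) = f' x / f x powr (\<gamma> / 2)"
      using f'pos[of x] x pos[OF x(1)] by (simp add: less_imp_le)
  qed simp
  ultimately have "((\<lambda>x. f' x / f x powr (\<gamma> / 2)) \<longlongrightarrow> sqrt 2) (at_right 0)"
    by (rule Lim_transform_eventually)
  then show ?thesis using pos sol by (simp add: half_profile_def)
qed

section \<open>Existence by iterating the solution operator\<close>

theorem half_profile_exists:
  assumes \<gamma>: "0 < \<gamma>" "\<gamma> \<le> 1"
  shows "\<exists>f f'. half_profile \<gamma> c f f'"
proof -
  let ?b = "beta \<gamma>"
  \<comment> \<open>Any choice will do: the contraction estimate \<open>contr\<close> holds for all
    solutions with the given sources and only sees x > 0.\<close>
  define T where "T f = (SOME g. \<exists>g'. source_solution \<gamma> c f g g')" for f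
  have T: "\<exists>g'. source_solution \<gamma> c f (T f) g'" if "power_like ?b f" for f
    unfolding T_def
    using someI_ex[OF source_solution_exists[OF \<gamma> that], of c] .
  then have T_like: "power_like ?b (T f)" if "power_like ?b f" for f
    using source_solution_power_like[OF \<gamma> that] that by blast
  have contr: "\<bar>ln (T f x) - ln (T g x)\<bar> \<le> (1 - \<gamma>) * a"
    if fg: "power_like ?b f" "power_like ?b g"
      and le: "\<And>x. 0 < x \<Longrightarrow> x \<le> R \<Longrightarrow> \<bar>ln (f x) - ln (g x)\<bar> \<le> a"
      and x: "0 < x" "x \<le> R" for f g a x R
  proof -
    obtain f' where f': "source_solution \<gamma> c f (T f) f'" using T[OF fg(1)] by blast
    obtain g' where g': "source_solution \<gamma> c g (T g) g'" using T[OF fg(2)] by blast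
    show ?thesis
      by (rule source_solution_ln_contraction[OF \<gamma> f' g' _ _ _ _ le x])
        (use power_like_pos fg T_like in blast)+
  qed
  define F where "F n = (T ^^ n) (\<lambda>x. x powr ?b)" for n
  have F_Suc: "F (Suc n) = T (F n)" for n by (simp add: F_def)
  have F_like: "power_like ?b (F n)" for n
    by (induction n) (auto simp: F_Suc T_like, simp add: F_def power_like_powr)
  have F_pos: "0 < F n x" if "0 < x" for n x
    using power_like_pos[OF F_like that] .
  \<comment> \<open>The limit is built from the telescoping series of logarithms starting at x^beta.
    Exponentiating makes it positive, and convergence is measured in the metric that the operator
    contracts.\<close>
  define d where "d n x = ln (F (Suc n) x) - ln (F n x)" for n x
  define G where "G x = (\<Sum>n. d n x)" for x
  define f where "f x = x powr ?b * exp (G x)" for x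
  have fpos: "0 < f x" if "0 < x" for x using that by (simp add: f_def)
  have unif: "uniform_limit {0<..R} (\<lambda>n x. ln (F n x)) (\<lambda>x. ln (f x)) sequentially" if R: "0 < R" for R
  proof -
    obtain a where a: "0 \<le> a" "\<And>x. 0 < x \<Longrightarrow> x \<le> R \<Longrightarrow> \<bar>ln (F 1 x) - ln (F 0 x)\<bar> \<le> a"
      using power_like_ln_diff_bounded[OF F_like F_like R] by metis
    have d_le: "0 < x \<Longrightarrow> x \<le> R \<Longrightarrow> \<bar>d n x\<bar> \<le> (1 - \<gamma>) ^ n * a" for n x
    proof (induction n arbitrary: x)
      case 0
      then show ?case using a by (simp add: d_def)
    next
      case (Suc n)
      have "\<bar>ln (T (F (Suc n)) x) - ln (T (F n) x)\<bar> \<le> (1 - \<gamma>) * ((1 - \<gamma>) ^ n * a)"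
        by (rule contr[OF F_like F_like]) (use Suc in \<open>auto simp: d_def\<close>)
      then show ?case by (simp add: d_def F_Suc mult.assoc)
    qed
    have lim: "uniform_limit {0<..R} (\<lambda>n x. \<Sum>i<n. d i x) G sequentially"
      unfolding G_def
    proof (rule Weierstrass_m_test)
      show "norm (d n x) \<le> (1 - \<gamma>) ^ n * a" if "x \<in> {0<..R}" for n x
        using d_le that by simp
      show "summable (\<lambda>n. (1 - \<gamma>) ^ n * a)"
        using \<gamma> by (intro summable_mult2 summable_geometric) auto
    qed
    have *: "uniform_limit {0<..R} (\<lambda>n x. ln (x powr ?b) + (\<Sum>i<n. d i x)) (\<lambda>x. ln (x powr ?b) + G x) sequentially"
      by (intro uniform_limit_intros lim)
    have F_eq: "ln (x powr ?b) + (\<Sum>i<n. d i x) = ln (F n x)" for n x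
      unfolding d_def by (subst sum_lessThan_telescope) (simp add: F_def)
    have f_eq: "ln (x powr ?b) + G x = ln (f x)" if "x \<in> {0<..R}" for x
      using that by (simp add: f_def ln_mult)
    from * show ?thesis
      using F_eq f_eq uniform_limit_cong'[of "{0<..R}" "\<lambda>n x. ln (x powr ?b) + (\<Sum>i<n. d i x)" "\<lambda>n x. ln (F n x)"
          "\<lambda>x. ln (x powr ?b) + G x" "\<lambda>x. ln (f x)" sequentially]
      by blast
  qed
  have f_like: "power_like ?b f"
    unfolding power_like_def
  proof (intro conjI allI impI)
    have "isCont f x" if x: "0 < x" for x
    proof -
      have "continuous_on {0<..x+1} (\<lambda>x. ln (f x))"
      proof (rule uniform_limit_theorem[OF _ unif])
        have "continuous_on {0<..x+1} (\<lambda>x. ln (F n x))" for n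
          using F_like[of n] F_pos
          by (intro continuous_intros)
            (auto simp: power_like_def less_imp_neq[THEN not_sym] intro: continuous_on_subset)
        then show "\<forall>\<^sub>F n in sequentially. continuous_on {0<..x+1} (\<lambda>x. ln (F n x))" by simp
      qed (use x in auto)
      then have "continuous_on {0<..<x+1} (\<lambda>x. exp (ln (f x)))"
        by (intro continuous_on_exp) (auto intro: continuous_on_subset)
      then have "continuous_on {0<..<x+1} f"
        by (rule continuous_on_eq) (simp add: fpos)
      then show ?thesis using x by (simp add: continuous_on_eq_continuous_at)
    qed
    then show "continuous_on {0<..} f" by (auto intro: continuous_at_imp_continuous_on)
    fix R :: real assume R: "0 < R"
    \<comment> \<open>A single iterate within logarithmic distance 1 suffices: its two-sided power
      bounds pass to \<open>f\<close> at the cost of the factors e^(-1) and e.\<close>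
    obtain n where n: "\<forall>x\<in>{0<..R}. dist (ln (F n x)) (ln (f x)) < 1"
      using uniform_limitD[OF unif[OF R] zero_less_one] unfolding eventually_sequentially by auto
    obtain m M where mM: "0 < m" "0 < M"
      "\<And>x. 0 < x \<Longrightarrow> x \<le> R \<Longrightarrow> m * x powr ?b \<le> F n x"
      "\<And>x. 0 < x \<Longrightarrow> x \<le> R \<Longrightarrow> F n x \<le> M * x powr ?b"
      using power_likeD[OF F_like R] by metis
    show "\<exists>m>0. \<exists>M>0. \<forall>x. 0 < x \<and> x \<le> R \<longrightarrow> m * x powr ?b \<le> f x \<and> f x \<le> M * x powr ?b"
    proof (rule exI[of _ "exp (-1) * m"], intro conjI exI[of _ "exp 1 * M"] allI impI)
      fix x assume x: "0 < x \<and> x \<le> R"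
      have *: "-1 + ln (F n x) \<le> ln (f x)" "ln (f x) \<le> 1 + ln (F n x)"
        using n x by (auto simp: dist_real_def dest!: bspec[of _ _ x])
      have "exp (-1 + ln (F n x)) \<le> exp (ln (f x))" "exp (ln (f x)) \<le> exp (1 + ln (F n x))"
        using * by (simp_all only: exp_le_cancel_iff)
      then have **: "exp (-1) * F n x \<le> f x" "f x \<le> exp 1 * F n x"
        unfolding exp_add using fpos F_pos x by simp_all
      have "exp (-1) * (m * x powr ?b) \<le> exp (-1) * F n x" "exp 1 * F n x \<le> exp 1 * (M * x powr ?b)"
        using mM(3,4) x by simp_all
      with ** show "exp (-1) * m * x powr ?b \<le> f x" "f x \<le> exp 1 * M * x powr ?b"
        unfolding mult.assoc by linarith+
    qed (use mM in auto)
  qed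
  have fix_point: "T f x = f x" if x: "0 < x" for x
  proof -
    have "\<bar>ln (T f x) - ln (f x)\<bar> \<le> e" if e: "0 < e" for e
    proof -
      \<comment> \<open>The iterate \<open>F (Suc N) = T (F N)\<close> is the intermediate point: it
        is close to \<open>T f\<close> by the contraction, since \<open>F N\<close> is close to
        \<open>f\<close>, and close to \<open>f\<close> by convergence.\<close>
      obtain N where "\<forall>n\<ge>N. \<forall>y\<in>{0<..x}. dist (ln (F n y)) (ln (f y)) < e / 2"
        using uniform_limitD[OF unif[OF x], of "e / 2"] e unfolding eventually_sequentially by auto
      then have N: "\<bar>ln (F n y) - ln (f y)\<bar> < e / 2" if "N \<le> n" "0 < y" "y \<le> x" for n y
        using that by (simp add: dist_real_def)
      have "\<bar>ln (T (F N) x) - ln (T f x)\<bar> \<le> (1 - \<gamma>) * (e / 2)"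
        by (rule contr[OF F_like f_like, of x]) (use N x in \<open>auto intro: less_imp_le\<close>)
      also have "\<dots> \<le> e / 2" using \<gamma> e by (simp add: mult_left_le_one_le)
      finally have "\<bar>ln (T (F N) x) - ln (T f x)\<bar> \<le> e / 2" .
      moreover have "\<bar>ln (T (F N) x) - ln (f x)\<bar> < e / 2"
        using N[of "Suc N" x] x by (simp only: F_Suc)
      ultimately show ?thesis by linarith
    qed
    then have "\<bar>ln (T f x) - ln (f x)\<bar> \<le> 0"
      by (rule field_le_epsilon[where y = 0, simplified])
    then show ?thesis using fpos power_like_pos[OF T_like[OF f_like]] x by simp
  qed
  obtain f' where "source_solution \<gamma> c f (T f) f'" using T[OF f_like] by blast
  \<comment> \<open>\<open>f\<close> and \<open>T f\<close> are known to agree only for x > 0. The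
    source is the side to rewrite, as it enters only through its values at such points, while
    \<open>T f\<close> already carries the derivatives.\<close>
  then have "source_solution \<gamma> c (T f) (T f) f'"
    by (simp add: source_solution_def fix_point)
  then show ?thesis using half_profileI_power_like[OF \<gamma> T_like[OF f_like]] by blast
qed

section \<open>Behaviour at infinity\<close>

lemma half_profileD:
  assumes "half_profile \<gamma> c f f'" "0 < x"
  shows "0 < f x" "(f has_real_derivative f' x) (at x)"
    "(f' has_real_derivative \<gamma> * f x powr (\<gamma> - 1) - c * f' x) (at x)"
  using assms by (auto simp: half_profile_def source_solution_def)

lemma half_profile_tendsto_0:
  assumes "half_profile \<gamma> c f f'"
  shows "(f \<longlongrightarrow> 0) (at_right 0)" "(f' \<longlongrightarrow> 0) (at_right 0)"
  using assms by (auto simp: half_profile_def source_solution_def)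

lemma half_profile_deriv_pos:
  assumes \<gamma>: "0 < \<gamma>" "\<gamma> \<le> 1" and p: "half_profile \<gamma> c f f'" and x: "0 < x"
  shows "0 < f' x"
proof -
  have "source_solution \<gamma> c f f f'" using p by (simp add: half_profile_def)
  then obtain m M where m: "0 < m" "0 < M" "\<And>y. 0 < y \<Longrightarrow> y \<le> x \<Longrightarrow> m * y powr (beta \<gamma> - 1) \<le> f' y"
    "\<And>y. 0 < y \<Longrightarrow> y \<le> x \<Longrightarrow> f' y \<le> M * y powr (beta \<gamma> - 1)"
    using source_solution_power_bounds[OF \<gamma> half_profile_power_like[OF \<gamma> p] _ x] by metis
  have "0 < m * x powr (beta \<gamma> - 1)" using m(1) x by simp
  with m(3)[OF x order_refl] show ?thesis by linarith
qed

lemma half_profile_mono: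
  assumes \<gamma>: "0 < \<gamma>" "\<gamma> \<le> 1" and p: "half_profile \<gamma> c f f'" and xy: "0 < x" "x \<le> y"
  shows "f x \<le> f y"
proof (rule DERIV_nonneg_imp_nondecreasing[OF xy(2)])
  fix z assume "x \<le> z" "z \<le> y"
  then have z: "0 < z" using xy by simp
  show "\<exists>d. (f has_real_derivative d) (at z) \<and> 0 \<le> d"
    using half_profileD(2)[OF p z] half_profile_deriv_pos[OF \<gamma> p z] by (blast intro: less_imp_le)
qed

text \<open>If the increasing function \<open>f\<close> stayed below \<open>Z\<close>, its source
  term would be at least k = \<gamma> Z^(\<gamma>-1) > 0. Integrating the equation once gives f' + c
  f \<ge> k x, and since c f \<le> |c| Z a second integration forces quadratic growth.\<close>

lemma half_profile_at_top:
  assumes \<gamma>: "0 < \<gamma>" "\<gamma> \<le> 1" and p: "half_profile \<gamma> c f f'"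
  shows "filterlim f at_top at_top"
proof (rule ccontr)
  note D = half_profileD[OF p] and L = half_profile_tendsto_0[OF p]
  assume "\<not> filterlim f at_top at_top"
  then obtain Z where Z: "\<not> (\<forall>\<^sub>F x in at_top. Z \<le> f x)"
    unfolding filterlim_at_top by blast
  have bnd: "f x \<le> Z" if x: "0 < x" for x
  proof (rule ccontr)
    assume "\<not> f x \<le> Z"
    then have "\<forall>y\<ge>x. Z \<le> f y" using half_profile_mono[OF \<gamma> p x] by force
    then show False using Z unfolding eventually_at_top_linorder by blast
  qed
  have Zpos: "0 < Z" using bnd[of 1] D(1)[of 1] by simp
  define k where "k = \<gamma> * Z powr (\<gamma> - 1)"
  have k: "0 < k" using \<gamma> Zpos by (simp add: k_def)
  have slope: "k * x \<le> f' x + c * f x" if x: "0 < x" for x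
  proof (rule le_of_deriv_le_at_right[where R = x and F = "\<lambda>x. k * x" and F' = "\<lambda>x. k" and
        G = "\<lambda>x. f' x + c * f x" and G' = "\<lambda>x. \<gamma> * f x powr (\<gamma> - 1)"])
    show "((\<lambda>x. f' x + c * f x) has_real_derivative \<gamma> * f y powr (\<gamma> - 1)) (at y)" if "0 < y" for y
      using D[OF that] by (auto intro!: derivative_eq_intros)
    show "((\<lambda>x. f' x + c * f x) \<longlongrightarrow> 0) (at_right 0)"
      using tendsto_add[OF L(2) tendsto_mult[OF tendsto_const L(1)]] by simp
    show "k \<le> \<gamma> * f y powr (\<gamma> - 1)" if "0 < y" for y
      unfolding k_def using \<gamma> D(1)[OF that] bnd[OF that] by (intro mult_left_mono powr_mono2') auto
  qed (use x in \<open>auto intro!: derivative_eq_intros tendsto_mult_right_zero tendsto_intros\<close>)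
  have lower: "x * (k / 2 * x - \<bar>c\<bar> * Z) \<le> f x" if x: "0 < x" for x
  proof (rule le_of_deriv_le_at_right[where R = x and F = "\<lambda>x. x * (k / 2 * x - \<bar>c\<bar> * Z)" and
        F' = "\<lambda>x. k * x - \<bar>c\<bar> * Z" and G = f and G' = f'])
    show "((\<lambda>x. x * (k / 2 * x - \<bar>c\<bar> * Z)) has_real_derivative k * y - \<bar>c\<bar> * Z) (at y)" for y
      by (auto intro!: derivative_eq_intros)
    show "((\<lambda>x. x * (k / 2 * x - \<bar>c\<bar> * Z)) \<longlongrightarrow> 0) (at_right 0)"
      by (auto intro!: tendsto_eq_intros)
    show "k * y - \<bar>c\<bar> * Z \<le> f' y" if y: "0 < y" for y
    proof -
      have "c * f y \<le> \<bar>c\<bar> * Z" using bnd[OF y] D(1)[OF y] by (intro mult_mono) auto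
      then show ?thesis using slope[OF y] by linarith
    qed
  qed (use x D L in auto)
  \<comment> \<open>Chosen so that the second factor of the lower bound at \<open>X\<close> is at
    least \<open>Z + 1\<close>; the first factor is at least 1, so \<open>f X\<close> exceeds
    \<open>Z\<close>.\<close>
  define X where "X = max 1 ((\<bar>c\<bar> * Z + Z + 1) * 2 / k)"
  have X: "1 \<le> X" "(\<bar>c\<bar> * Z + Z + 1) * 2 / k \<le> X" by (auto simp: X_def)
  then have "Z + 1 \<le> k / 2 * X - \<bar>c\<bar> * Z" using k by (simp add: field_simps)
  then have "1 * (Z + 1) \<le> X * (k / 2 * X - \<bar>c\<bar> * Z)" using X Zpos by (intro mult_mono) auto
  then show False using lower[of X] bnd[of X] X(1) by simp
qed

text \<open>As \<open>f\<close> increases, its source term on [1,\<infinity>) is at most its value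
  \<open>B\<close> at 1. Integrating \<open>B * exp (c * x)\<close> bounds the flux itself if c < 0,
  and bounds \<open>f'\<close> after division by the weight if c > 0.\<close>

lemma half_profile_flux_le:
  assumes \<gamma>: "0 < \<gamma>" "\<gamma> \<le> 1" and p: "half_profile \<gamma> c f f'" and c: "c \<noteq> 0"
  shows "\<exists>A. \<exists>B>0. \<forall>x\<ge>1. exp (c * x) * f' x \<le> A + B / c * exp (c * x)"
proof -
  define B where "B = \<gamma> * f 1 powr (\<gamma> - 1)"
  define D where "D x = exp (c * x) * f' x - B / c * exp (c * x)" for x
  have f1: "0 < f 1" using half_profileD(1)[OF p] by simp
  have sol: "source_solution \<gamma> c f f f'" using p by (simp add: half_profile_def)
  have "D x \<le> D 1" if x: "1 \<le> x" for x
  proof (rule DERIV_nonpos_imp_nonincreasing[OF x])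
    fix y assume y: "1 \<le> y" "y \<le> x"
    have "(D has_real_derivative \<gamma> * exp (c * y) * f y powr (\<gamma> - 1) - B * exp (c * y)) (at y)"
      unfolding D_def
      by (rule DERIV_diff[OF source_solution_flux(1)[OF sol]])
        (use y c in \<open>auto intro!: derivative_eq_intros\<close>)
    moreover have "f y powr (\<gamma> - 1) \<le> f 1 powr (\<gamma> - 1)"
      using \<gamma> f1 half_profile_mono[OF \<gamma> p, of 1 y] y by (intro powr_mono2') auto
    then have "\<gamma> * exp (c * y) * f y powr (\<gamma> - 1) - B * exp (c * y) \<le> 0"
      using \<gamma> by (simp add: B_def mult.commute mult.left_commute mult_left_mono)
    ultimately show "\<exists>d. (D has_real_derivative d) (at y) \<and> d \<le> 0" by blast
  qed
  then show ?thesis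
    by (intro exI[of _ "D 1"] exI[of _ B]) (use \<gamma> f1 in \<open>auto simp: B_def D_def algebra_simps\<close>)
qed

text \<open>The flux increases and is bounded above, so it has a limit L > 0 and f' behaves like L
  e^(-cx). Comparing with the derivative -c e^(-cx) gives k = L / (-c).\<close>

lemma half_profile_asymp_exp:
  assumes \<gamma>: "0 < \<gamma>" "\<gamma> \<le> 1" and p: "half_profile \<gamma> c f f'" and c: "c < 0"
  shows "\<exists>k>0. f \<sim>[at_top] (\<lambda>x. k * exp (- c * x))"
proof -
  note D = half_profileD[OF p]
  have sol: "source_solution \<gamma> c f f f'" using p by (simp add: half_profile_def)
  define v where "v x = exp (c * x) * f' x" for x
  obtain A B where "0 < B" "\<forall>x\<ge>1. v x \<le> A + B / c * exp (c * x)"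
    using half_profile_flux_le[OF \<gamma> p less_imp_neq[OF c]] unfolding v_def by blast
  then have AB: "0 < B" "\<And>x. 1 \<le> x \<Longrightarrow> v x \<le> A + B / c * exp (c * x)" by simp_all
  have v_le: "v x \<le> A" if "1 \<le> x" for x
  proof -
    have "B / c * exp (c * x) \<le> 0" using AB(1) c by (simp add: divide_nonneg_neg mult_nonpos_nonneg)
    then show ?thesis using AB(2)[OF that] by linarith
  qed
  have v_mono: "v x \<le> v y" if xy: "0 < x" "x \<le> y" for x y
  proof (rule DERIV_nonneg_imp_nondecreasing[OF xy(2)])
    fix z assume z: "x \<le> z" "z \<le> y"
    then show "\<exists>d. (v has_real_derivative d) (at z) \<and> 0 \<le> d"
      unfolding v_def using source_solution_flux(1)[OF sol, of z] xy \<gamma>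
      by (intro exI[of _ "\<gamma> * exp (c * z) * f z powr (\<gamma> - 1)"]) auto
  qed
  define L where "L = Sup (v ` {1..})"
  have bdd: "bdd_above (v ` {1..})" using v_le by (auto intro!: bdd_aboveI2)
  have v_L: "v x \<le> L" if "1 \<le> x" for x
    unfolding L_def using that by (intro cSUP_upper bdd) auto
  have "0 < v 1" using half_profile_deriv_pos[OF \<gamma> p] by (simp add: v_def)
  then have Lpos: "0 < L" using v_L[of 1] by simp
  have v_lim: "(v \<longlongrightarrow> L) at_top"
  proof (rule increasing_tendsto)
    show "\<forall>\<^sub>F x in at_top. v x \<le> L"
      using v_L unfolding eventually_at_top_linorder by blast
    fix l assume "l < L"
    then obtain x where x: "1 \<le> x" "l < v x"
      unfolding L_def by (auto simp: less_cSUP_iff[OF _ bdd])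
    have "l < v y" if "x \<le> y" for y using v_mono[of x y] x that by linarith
    then show "\<forall>\<^sub>F y in at_top. l < v y" unfolding eventually_at_top_linorder by blast
  qed
  define k where "k = L / - c"
  have k: "0 < k" using divide_pos_pos[OF Lpos, of "- c"] c by (simp add: k_def)
  have "((\<lambda>x. f x / exp (- c * x)) \<longlongrightarrow> k) at_top"
  proof (rule lhospital_at_top_at_top)
    show "LIM x at_top. exp (- c * x) :> at_top"
      by (intro filterlim_compose[OF exp_at_top] filterlim_tendsto_pos_mult_at_top[OF tendsto_const])
        (use c in \<open>auto intro: filterlim_ident\<close>)
    show "\<forall>\<^sub>F x in at_top. (f has_real_derivative f' x) (at x)"
      using eventually_gt_at_top[of 0] by eventually_elim (rule D(2))
    show "\<forall>\<^sub>F x in at_top. ((\<lambda>x. exp (- c * x)) has_real_derivative - c * exp (- c * x)) (at x)"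
      by (auto intro!: always_eventually derivative_eq_intros)
    show "\<forall>\<^sub>F x in at_top. - c * exp (- c * x) \<noteq> 0" using c by simp
    have "((\<lambda>x. v x / - c) \<longlongrightarrow> k) at_top"
      unfolding k_def using c by (intro tendsto_intros v_lim) auto
    moreover have "v x / - c = f' x / (- c * exp (- c * x))" for x
      by (simp add: v_def exp_minus field_simps)
    ultimately show "((\<lambda>x. f' x / (- c * exp (- c * x))) \<longlongrightarrow> k) at_top" by simp
  qed
  then have "((\<lambda>x. f x / exp (- c * x) / k) \<longlongrightarrow> k / k) at_top"
    using k by (intro tendsto_divide tendsto_const) auto
  then have "((\<lambda>x. f x / (k * exp (- c * x))) \<longlongrightarrow> 1) at_top"
    using k by (simp add: mult.commute)
  then show ?thesis by (intro exI[of _ k] conjI k asymp_equivI')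
qed

text \<open>The claim amounts to f^(1-\<gamma>) f' tending to \<gamma>/c, the balance of the
  first-order term with the source. Multiplying numerator and denominator by e^(cx) lets the
  equation eliminate f'' in l'Hopital's rule.\<close>

lemma half_profile_asymp_powr:
  assumes \<gamma>: "0 < \<gamma>" "\<gamma> \<le> 1" and p: "half_profile \<gamma> c f f'" and c: "0 < c"
  shows "f \<sim>[at_top] (\<lambda>x. (2 * \<gamma> / (beta \<gamma> * c) * x) powr (beta \<gamma> / 2))"
proof -
  let ?b = "beta \<gamma>"
  note D = half_profileD[OF p]
  note b = beta_facts[OF \<gamma>]
  have sol: "source_solution \<gamma> c f f f'" using p by (simp add: half_profile_def)
  have top: "filterlim f at_top at_top" by (rule half_profile_at_top[OF \<gamma> p])
  obtain A B where "0 < B" "\<forall>x\<ge>1. exp (c * x) * f' x \<le> A + B / c * exp (c * x)"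
    using half_profile_flux_le[OF \<gamma> p less_imp_neq[OF c, symmetric]] by blast
  then have AB: "0 < B" "\<And>x. 1 \<le> x \<Longrightarrow> exp (c * x) * f' x \<le> A + B / c * exp (c * x)" by simp_all
  define M where "M = \<bar>A\<bar> + B / c"
  have f'_le: "f' x \<le> M" if x: "1 \<le> x" for x
  proof -
    have "1 \<le> exp (c * x)" using c x by simp
    then have "\<bar>A\<bar> * 1 \<le> \<bar>A\<bar> * exp (c * x)" by (intro mult_left_mono) auto
    then have "exp (c * x) * f' x \<le> exp (c * x) * M"
      using AB(2)[OF x] by (simp add: M_def algebra_simps)
    then show ?thesis by simp
  qed
  have "((\<lambda>x. M\<^sup>2 * f x powr (- \<gamma>)) \<longlongrightarrow> 0) at_top"
    using \<gamma> by (intro tendsto_mult_right_zero tendsto_neg_powr top) auto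
  moreover have "\<forall>\<^sub>F x in at_top. norm ((f' x)\<^sup>2 * f x powr (- \<gamma>)) \<le> M\<^sup>2 * f x powr (- \<gamma>)"
    unfolding eventually_at_top_linorder
  proof (intro exI[of _ 1] allI impI)
    fix x :: real assume x: "1 \<le> x"
    have "(f' x)\<^sup>2 \<le> M\<^sup>2"
      using f'_le[OF x] half_profile_deriv_pos[OF \<gamma> p, of x] x by (intro power_mono) auto
    then show "norm ((f' x)\<^sup>2 * f x powr (- \<gamma>)) \<le> M\<^sup>2 * f x powr (- \<gamma>)"
      by (simp add: abs_mult mult_right_mono)
  qed
  \<comment> \<open>This is the only error term in the differentiated quotient. It vanishes at
    infinity because \<open>f'\<close> stays bounded while \<open>f\<close> tends to
    infinity.\<close>
  ultimately have small: "((\<lambda>x. (f' x)\<^sup>2 * f x powr (- \<gamma>)) \<longlongrightarrow> 0) at_top"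
    by (auto intro: Lim_null_comparison)
  have dpow: "((\<lambda>x. f x powr a) has_real_derivative a * f x powr (a - 1) * f' x) (at x)" if "0 < x" for a x
    using DERIV_fun_powr[OF D(2)[OF that] D(1)[OF that], of a] by simp
  have "((\<lambda>x. f x powr (1 - \<gamma>) * (exp (c * x) * f' x) / exp (c * x)) \<longlongrightarrow> \<gamma> / c) at_top"
  proof (rule lhospital_at_top_at_top)
    show "LIM x at_top. exp (c * x) :> at_top"
      by (intro filterlim_compose[OF exp_at_top] filterlim_tendsto_pos_mult_at_top[OF tendsto_const])
        (use c in \<open>auto intro: filterlim_ident\<close>)
    show "\<forall>\<^sub>F x in at_top. ((\<lambda>x. exp (c * x)) has_real_derivative c * exp (c * x)) (at x)"
      by (auto intro!: always_eventually derivative_eq_intros)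
    show "\<forall>\<^sub>F x in at_top. c * exp (c * x) \<noteq> 0" using c by simp
    show "\<forall>\<^sub>F x in at_top. ((\<lambda>x. f x powr (1 - \<gamma>) * (exp (c * x) * f' x)) has_real_derivative
        exp (c * x) * (\<gamma> + (1 - \<gamma>) * ((f' x)\<^sup>2 * f x powr (- \<gamma>)))) (at x)"
      using eventually_gt_at_top[of 0]
    proof eventually_elim
      case (elim x)
      have "f x powr (1 - \<gamma>) * f x powr (\<gamma> - 1) = 1"
        using D(1)[OF elim] by (simp flip: powr_add)
      then have "\<gamma> * exp (c * x) * f x powr (\<gamma> - 1) * f x powr (1 - \<gamma>) = \<gamma> * exp (c * x)"
        by (metis mult.assoc mult.commute mult.right_neutral)
      then show ?case
        by (intro DERIV_cong[OF DERIV_mult[OF dpow[OF elim, of "1 - \<gamma>"] source_solution_flux(1)[OF sol elim]]])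
          (simp add: power2_eq_square distrib_left)
    qed
    have "((\<lambda>x. (\<gamma> + (1 - \<gamma>) * ((f' x)\<^sup>2 * f x powr (- \<gamma>))) / c) \<longlongrightarrow> (\<gamma> + (1 - \<gamma>) * 0) / c) at_top"
      using c by (intro tendsto_intros small) auto
    then show "((\<lambda>x. exp (c * x) * (\<gamma> + (1 - \<gamma>) * ((f' x)\<^sup>2 * f x powr (- \<gamma>))) / (c * exp (c * x))) \<longlongrightarrow> \<gamma> / c) at_top"
      by simp
  qed
  then have z: "((\<lambda>x. f x powr (1 - \<gamma>) * f' x) \<longlongrightarrow> \<gamma> / c) at_top" by simp
  \<comment> \<open>This is the limit of the derivative (2-\<gamma>) f^(1-\<gamma>) f' of
    f^(2-\<gamma>), rewritten with 2 - \<gamma> = 2/beta. The later power beta/2 = 1/(2-\<gamma>)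
    recovers \<open>f\<close>.\<close>
  define K where "K = 2 * \<gamma> / (?b * c)"
  have K: "0 < K" "K = (2 - \<gamma>) * (\<gamma> / c)"
    using \<gamma> c b(1) by (auto simp: K_def beta_def)
  have "((\<lambda>x. f x powr (2 - \<gamma>) / x) \<longlongrightarrow> K) at_top"
  proof (rule lhospital_at_top_at_top)
    show "\<forall>\<^sub>F x in at_top. ((\<lambda>x. f x powr (2 - \<gamma>)) has_real_derivative
        (2 - \<gamma>) * (f x powr (1 - \<gamma>) * f' x)) (at x)"
      using eventually_gt_at_top[of 0]
    proof eventually_elim
      case (elim x)
      then show ?case using dpow[OF elim, of "2 - \<gamma>"] by (simp add: mult.assoc)
    qed
    show "((\<lambda>x. (2 - \<gamma>) * (f x powr (1 - \<gamma>) * f' x) / 1) \<longlongrightarrow> K) at_top"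
      unfolding K(2) div_by_1 by (intro tendsto_intros z)
  qed (auto intro: filterlim_ident)
  then have "((\<lambda>x. (f x powr (2 - \<gamma>) / x / K) powr (?b / 2)) \<longlongrightarrow> (K / K) powr (?b / 2)) at_top"
    using K(1) by (intro tendsto_intros) auto
  moreover have "\<forall>\<^sub>F x in at_top. (f x powr (2 - \<gamma>) / x / K) powr (?b / 2) = f x / (K * x) powr (?b / 2)"
    using eventually_gt_at_top[of 0]
  proof eventually_elim
    case (elim x)
    have "(2 - \<gamma>) * (?b / 2) = 1" using \<gamma> by (simp add: beta_def)
    then have "(f x powr (2 - \<gamma>)) powr (?b / 2) = f x"
      using D(1)[OF elim] by (simp add: powr_powr)
    moreover have "f x powr (2 - \<gamma>) / x / K = f x powr (2 - \<gamma>) / (K * x)" by simp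
    ultimately show ?case
      using elim K(1) by (simp only: powr_divide[of "f x powr (2 - \<gamma>)"] powr_ge_zero mult_nonneg_nonneg less_imp_le)
  qed
  ultimately have "((\<lambda>x. f x / (K * x) powr (?b / 2)) \<longlongrightarrow> 1) at_top"
    using K(1) by (simp add: Lim_transform_eventually)
  then show ?thesis unfolding K_def[symmetric] by (rule asymp_equivI')
qed

section \<open>Admissible profiles\<close>

lemma open_support:
  fixes \<phi> :: "real \<Rightarrow> real"
  shows "continuous_on UNIV \<phi> \<Longrightarrow> open {y. 0 < \<phi> y}"
  by (intro open_Collect_less continuous_intros)

text \<open>The free boundary condition is restated through the ratio phi' / phi^(\<gamma>/2), so
  that no later argument has to differentiate a root of phi.\<close>

lemma admissibleD:
  assumes \<gamma>: "0 < \<gamma>" "\<gamma> \<le> 1" and adm: "admissible \<gamma> c \<phi>"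
  shows "continuous_on UNIV \<phi>" "0 \<le> \<phi> x" "\<exists>x. 0 < \<phi> x" "\<exists>x. \<phi> x = 0"
    and "0 < \<phi> x \<Longrightarrow> (\<phi> has_real_derivative deriv \<phi> x) (at x)"
    and "0 < \<phi> x \<Longrightarrow> (deriv \<phi> has_real_derivative \<gamma> * \<phi> x powr (\<gamma> - 1) - c * deriv \<phi> x) (at x)"
    and "a \<in> frontier {y. 0 < \<phi> y} \<Longrightarrow>
      ((\<lambda>x. \<bar>deriv \<phi> x / \<phi> x powr (\<gamma> / 2)\<bar>) \<longlongrightarrow> sqrt 2) (at a within {y. 0 < \<phi> y})"
proof -
  show cont: "continuous_on UNIV \<phi>" and nonneg: "0 \<le> \<phi> x" for x
    using adm by (auto simp: admissible_def)
  then show "\<exists>x. 0 < \<phi> x" "\<exists>x. \<phi> x = 0"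
    using adm unfolding admissible_def by (metis order_le_less)+
  have ode: "\<phi> differentiable (at x)" "deriv \<phi> differentiable (at x)"
    "c * deriv \<phi> x + deriv (deriv \<phi>) x = \<gamma> * \<phi> x powr (\<gamma> - 1)" if "0 < \<phi> x" for x
    using adm that by (auto simp: admissible_def)
  show der: "(\<phi> has_real_derivative deriv \<phi> x) (at x)" if "0 < \<phi> x" for x
    using ode(1)[OF that] by (simp add: DERIV_deriv_iff_real_differentiable)
  show "(deriv \<phi> has_real_derivative \<gamma> * \<phi> x powr (\<gamma> - 1) - c * deriv \<phi> x) (at x)" if "0 < \<phi> x"
    using ode(2)[OF that] ode(3)[OF that, symmetric] by (simp add: DERIV_deriv_iff_real_differentiable)
  assume "a \<in> frontier {y. 0 < \<phi> y}"
  then have "((\<lambda>x. \<bar>deriv (\<lambda>t. \<phi> t powr (1 / beta \<gamma>)) x\<bar>) \<longlongrightarrow> sqrt 2 / beta \<gamma>) (at a within {y. 0 < \<phi> y})"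
    using adm by (auto simp: admissible_def)
  then have "((\<lambda>x. \<bar>deriv (\<lambda>t. \<phi> t powr (1 / beta \<gamma>)) x\<bar> * beta \<gamma>) \<longlongrightarrow> sqrt 2 / beta \<gamma> * beta \<gamma>) (at a within {y. 0 < \<phi> y})"
    by (intro tendsto_mult tendsto_const)
  moreover have "\<bar>deriv (\<lambda>t. \<phi> t powr (1 / beta \<gamma>)) x\<bar> * beta \<gamma> = \<bar>deriv \<phi> x / \<phi> x powr (\<gamma> / 2)\<bar>" if x: "0 < \<phi> x" for x
    using DERIV_imp_deriv[OF has_real_derivative_root_beta[OF \<gamma> der[OF x] x]] beta_facts(1)[OF \<gamma>]
    by (simp add: abs_mult)
  then have "\<forall>\<^sub>F x in at a within {y. 0 < \<phi> y}.
      \<bar>deriv (\<lambda>t. \<phi> t powr (1 / beta \<gamma>)) x\<bar> * beta \<gamma> = \<bar>deriv \<phi> x / \<phi> x powr (\<gamma> / 2)\<bar>"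
    by (simp add: eventually_at_filter)
  ultimately show "((\<lambda>x. \<bar>deriv \<phi> x / \<phi> x powr (\<gamma> / 2)\<bar>) \<longlongrightarrow> sqrt 2) (at a within {y. 0 < \<phi> y})"
    using beta_facts(1)[OF \<gamma>] by (simp add: Lim_transform_eventually)
qed

lemma admissibleI:
  assumes \<gamma>: "0 < \<gamma>" "\<gamma> \<le> 1"
    and cont: "continuous_on UNIV \<phi>" and nonneg: "\<And>x. 0 \<le> \<phi> x"
    and ex: "\<exists>x. 0 < \<phi> x" "\<exists>x. \<phi> x = 0"
    and der: "\<And>x. 0 < \<phi> x \<Longrightarrow> (\<phi> has_real_derivative d x) (at x)"
    and der2: "\<And>x. 0 < \<phi> x \<Longrightarrow> (d has_real_derivative \<gamma> * \<phi> x powr (\<gamma> - 1) - c * d x) (at x)"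
    and lim: "\<And>a. a \<in> frontier {y. 0 < \<phi> y} \<Longrightarrow>
      ((\<lambda>x. \<bar>d x / \<phi> x powr (\<gamma> / 2)\<bar>) \<longlongrightarrow> sqrt 2) (at a within {y. 0 < \<phi> y})"
  shows "admissible \<gamma> c \<phi>"
  unfolding admissible_def
proof (intro conjI ballI allI)
  let ?S = "{y. 0 < \<phi> y}"
  note op = open_support[OF cont]
  have d1: "deriv \<phi> x = d x" if "x \<in> ?S" for x
    using DERIV_imp_deriv[OF der] that by simp
  \<comment> \<open>\<open>deriv \<phi>\<close> and \<open>d\<close> agree only where phi is
    positive. That set is open, so the derivative transfers.\<close>
  have D2: "(deriv \<phi> has_real_derivative \<gamma> * \<phi> x powr (\<gamma> - 1) - c * d x) (at x)" if "x \<in> ?S" for x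
    by (rule has_field_derivative_transform_within_open[OF der2 op that]) (use d1 that in auto)
  have d2: "deriv (deriv \<phi>) x = \<gamma> * \<phi> x powr (\<gamma> - 1) - c * d x" if "x \<in> ?S" for x
    using DERIV_imp_deriv[OF D2[OF that]] .
  show "continuous_on UNIV \<phi>" "0 \<le> \<phi> x" for x by (fact cont nonneg)+
  show "\<not> (\<forall>x. \<phi> x = 0)" "\<not> (\<forall>x. 0 < \<phi> x)" using ex by (metis less_irrefl)+
  {
    fix x assume x: "x \<in> ?S"
    show "\<phi> differentiable (at x)" "deriv \<phi> differentiable (at x)"
      using der[of x] D2[OF x] x by (auto simp: real_differentiable_def)
    show "c * deriv \<phi> x + deriv (deriv \<phi>) x = \<gamma> * \<phi> x powr (\<gamma> - 1)"
      using d1 d2 x by simp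
    have "isCont (\<lambda>x. \<gamma> * \<phi> x powr (\<gamma> - 1) - c * d x) x"
      using x DERIV_isCont[OF der] DERIV_isCont[OF der2] by (intro continuous_intros) auto
    moreover have "\<forall>\<^sub>F y in nhds x. deriv (deriv \<phi>) y = \<gamma> * \<phi> y powr (\<gamma> - 1) - c * d y"
      using d2 op x unfolding eventually_nhds by blast
    ultimately show "isCont (deriv (deriv \<phi>)) x" by (simp cong: isCont_cong)
  }
  fix a assume a: "a \<in> frontier ?S"
  have "((\<lambda>x. \<bar>d x / \<phi> x powr (\<gamma> / 2)\<bar> / beta \<gamma>) \<longlongrightarrow> sqrt 2 / beta \<gamma>) (at a within ?S)"
    using beta_facts(1)[OF \<gamma>] by (intro tendsto_divide lim[OF a] tendsto_const) auto
  moreover have "\<bar>d x / \<phi> x powr (\<gamma> / 2)\<bar> / beta \<gamma> = \<bar>deriv (\<lambda>t. \<phi> t powr (1 / beta \<gamma>)) x\<bar>" if x: "0 < \<phi> x" for x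
    using DERIV_imp_deriv[OF has_real_derivative_root_beta[OF \<gamma> der[OF x] x]] beta_facts(1)[OF \<gamma>]
    by (simp add: abs_mult)
  then have "\<forall>\<^sub>F x in at a within ?S.
      \<bar>d x / \<phi> x powr (\<gamma> / 2)\<bar> / beta \<gamma> = \<bar>deriv (\<lambda>t. \<phi> t powr (1 / beta \<gamma>)) x\<bar>"
    by (simp add: eventually_at_filter)
  ultimately show "((\<lambda>x. \<bar>deriv (\<lambda>t. \<phi> t powr (1 / beta \<gamma>)) x\<bar>) \<longlongrightarrow> sqrt 2 / beta \<gamma>) (at a within ?S)"
    by (rule Lim_transform_eventually)
qed

lemma admissible_reflect:
  assumes \<gamma>: "0 < \<gamma>" "\<gamma> \<le> 1" and adm: "admissible \<gamma> c \<phi>"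
  shows "admissible \<gamma> (- c) (\<lambda>x. \<phi> (- x))"
proof (rule admissibleI[OF \<gamma>, where d = "\<lambda>x. - deriv \<phi> (- x)"])
  note D = admissibleD[OF \<gamma> adm]
  show "continuous_on UNIV (\<lambda>x. \<phi> (- x))"
    by (rule continuous_on_compose2[OF D(1)]) (auto intro: continuous_intros)
  show "0 \<le> \<phi> (- x)" for x by (rule D(2))
  show "\<exists>x. 0 < \<phi> (- x)" "\<exists>x. \<phi> (- x) = 0" using D(3,4) by (metis minus_minus)+
  show "((\<lambda>x. \<phi> (- x)) has_real_derivative - deriv \<phi> (- x)) (at x)" if "0 < \<phi> (- x)" for x
    using D(5)[OF that] by (simp add: DERIV_mirror)
  show "((\<lambda>x. - deriv \<phi> (- x)) has_real_derivative
      \<gamma> * \<phi> (- x) powr (\<gamma> - 1) - - c * - deriv \<phi> (- x)) (at x)" if "0 < \<phi> (- x)" for x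
    using DERIV_minus[OF D(6)[OF that, unfolded DERIV_mirror]] by simp
  fix a assume a: "a \<in> frontier {y. 0 < \<phi> (- y)}"
  have "{y. 0 < \<phi> (- y)} = uminus ` {y. 0 < \<phi> y}"
    by (force intro: image_eqI[of _ _ "- _"])
  moreover have "closure (uminus ` S) = uminus ` closure S" for S :: "real set"
    by (rule closure_injective_linear_image[symmetric]) (auto simp: linear_uminus)
  ultimately have "- a \<in> frontier {y. 0 < \<phi> y}"
    using a by (auto simp: frontier_def interior_negations)
  from D(7)[OF this]
  have "((\<lambda>x. \<bar>deriv \<phi> (- x) / \<phi> (- x) powr (\<gamma> / 2)\<bar>) \<longlongrightarrow> sqrt 2) (at a within {y. 0 < \<phi> (- y)})"
    by (rule filterlim_compose)
      (auto simp: filterlim_at eventually_at_filter intro!: tendsto_intros)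
  then show "((\<lambda>x. \<bar>- deriv \<phi> (- x) / \<phi> (- x) powr (\<gamma> / 2)\<bar>) \<longlongrightarrow> sqrt 2) (at a within {y. 0 < \<phi> (- y)})"
    by simp
qed

lemma half_profile_admissible:
  assumes \<gamma>: "0 < \<gamma>" "\<gamma> \<le> 1" and p: "half_profile \<gamma> c f f'"
  shows "admissible \<gamma> c (\<lambda>x. if x \<le> 0 then 0 else f x)" (is "admissible _ _ ?\<phi>")
proof (rule admissibleI[OF \<gamma>, where d = f'])
  note D = half_profileD[OF p]
  have supp: "0 < ?\<phi> x \<longleftrightarrow> 0 < x" for x using D(1) by auto
  have "isCont ?\<phi> x" for x
  proof (cases x "0 :: real" rule: linorder_cases)
    case less
    have "\<forall>\<^sub>F y in nhds x. y < 0" using less eventually_nhds_in_open[of "{..<0}" x] by simp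
    then have "\<forall>\<^sub>F y in nhds x. ?\<phi> y = 0" by eventually_elim simp
    then show ?thesis by (simp cong: isCont_cong)
  next
    case equal
    have "(?\<phi> \<longlongrightarrow> 0) (at_right 0)"
      by (rule Lim_transform_eventually[OF half_profile_tendsto_0(1)[OF p]]) (auto simp: eventually_at_filter)
    moreover have "(?\<phi> \<longlongrightarrow> 0) (at_left 0)"
      by (rule Lim_transform_eventually[OF tendsto_const]) (auto simp: eventually_at_filter)
    ultimately show ?thesis using equal by (simp add: isCont_def filterlim_at_split)
  next
    case greater
    have "\<forall>\<^sub>F y in nhds x. 0 < y" using greater eventually_nhds_in_open[of "{0<..}" x] by simp
    then have "\<forall>\<^sub>F y in nhds x. ?\<phi> y = f y" by eventually_elim simp
    with DERIV_isCont[OF D(2)[OF greater]] show ?thesis by (simp cong: isCont_cong)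
  qed
  then show "continuous_on UNIV ?\<phi>" by (simp add: continuous_on_eq_continuous_within)
  show "0 \<le> ?\<phi> x" for x using D(1)[of x] by (auto intro: less_imp_le)
  show "\<exists>x. 0 < ?\<phi> x" using D(1)[of 1] by (intro exI[of _ 1]) simp
  show "\<exists>x. ?\<phi> x = 0" by (intro exI[of _ 0]) simp
  show "(?\<phi> has_real_derivative f' x) (at x)" if "0 < ?\<phi> x" for x
    by (rule has_real_derivative_cong_at_right[OF D(2), where a = 0]) (use that supp in auto)
  show "(f' has_real_derivative \<gamma> * ?\<phi> x powr (\<gamma> - 1) - c * f' x) (at x)" if "0 < ?\<phi> x" for x
    using that supp[of x] D(3)[of x] by simp
  fix a assume "a \<in> frontier {y. 0 < ?\<phi> y}"
  moreover have S: "{y. 0 < ?\<phi> y} = {0<..}" using supp by auto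
  ultimately have a: "a = 0" by (simp add: frontier_def interior_open)
  have "((\<lambda>x. \<bar>f' x / f x powr (\<gamma> / 2)\<bar>) \<longlongrightarrow> \<bar>sqrt 2\<bar>) (at_right 0)"
    using p by (intro tendsto_rabs) (simp add: half_profile_def)
  then have "((\<lambda>x. \<bar>f' x / ?\<phi> x powr (\<gamma> / 2)\<bar>) \<longlongrightarrow> \<bar>sqrt 2\<bar>) (at_right 0)"
    by (rule Lim_transform_eventually) (auto simp: eventually_at_filter)
  then show "((\<lambda>x. \<bar>f' x / ?\<phi> x powr (\<gamma> / 2)\<bar>) \<longlongrightarrow> sqrt 2) (at a within {y. 0 < ?\<phi> y})"
    unfolding S a by simp
qed

text \<open>The equation makes the profile strictly convex at critical points, so a bump between two zeros is impossible.\<close>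

lemma admissible_zero_between:
  assumes \<gamma>: "0 < \<gamma>" "\<gamma> \<le> 1" and adm: "admissible \<gamma> c \<phi>"
    and ord: "l < t" "t < r" and zero: "\<phi> l = 0" "\<phi> r = 0"
  shows "\<phi> t = 0"
proof (rule ccontr)
  note D = admissibleD[OF \<gamma> adm]
  assume "\<phi> t \<noteq> 0"
  then have t: "0 < \<phi> t" using D(2)[of t] by simp
  have "continuous_on {l..r} \<phi>" using D(1) by (rule continuous_on_subset) simp
  then obtain m where m: "m \<in> {l..r}" "\<And>y. y \<in> {l..r} \<Longrightarrow> \<phi> y \<le> \<phi> m"
    using continuous_attains_sup[of "{l..r}" \<phi>] ord by auto
  have mpos: "0 < \<phi> m" using m(2)[of t] t ord by simp
  then have lmr: "l < m" "m < r" using m(1) zero by (auto simp: order_le_less)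
  have zero': "deriv \<phi> m = 0"
  proof (rule DERIV_local_max[OF D(5)[OF mpos], of "min (m - l) (r - m)"])
    show "\<forall>y. \<bar>m - y\<bar> < min (m - l) (r - m) \<longrightarrow> \<phi> y \<le> \<phi> m"
      by (intro allI impI m(2)) (auto simp: abs_if split: if_splits)
  qed (use lmr in auto)
  have "0 < \<gamma> * \<phi> m powr (\<gamma> - 1)" using \<gamma> mpos by simp
  then obtain e where e: "0 < e" "\<And>h. 0 < h \<Longrightarrow> h < e \<Longrightarrow> deriv \<phi> m < deriv \<phi> (m + h)"
    using DERIV_pos_inc_right[OF D(6)[OF mpos]] zero' by auto
  have "open {y. 0 < \<phi> y}" by (rule open_support[OF D(1)])
  then obtain e' where e': "0 < e'" "\<And>y. dist y m < e' \<Longrightarrow> 0 < \<phi> y"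
    using mpos unfolding open_dist by blast
  \<comment> \<open>Small enough to stay left of \<open>r\<close>, inside the positivity set, and
    where the derivative has become positive just to the right of the maximum point.\<close>
  define h where "h = min (min e e') (r - m) / 2"
  have h: "0 < h" "h < e" "h < e'" "h < r - m" using e e' lmr by (auto simp: h_def)
  have "\<phi> m < \<phi> (m + h)"
  proof (rule DERIV_pos_imp_increasing_open[of m "m + h" \<phi>])
    fix y assume y: "m < y" "y < m + h"
    have "0 < \<phi> y" using e'(2)[of y] y h by (simp add: dist_real_def)
    moreover have "0 < deriv \<phi> y" using e(2)[of "y - m"] y h zero' by simp
    ultimately show "\<exists>d. (\<phi> has_real_derivative d) (at y) \<and> 0 < d" using D(5) by blast
  next
    show "continuous_on {m..m + h} \<phi>" using D(1) by (rule continuous_on_subset) simp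
  qed (use h in simp)
  then show False using m(2)[of "m + h"] h lmr by simp
qed

text \<open>Take \<open>a\<close> to be the last zero in [z,x]. A further zero to its right would
  lie beyond \<open>x\<close>, leaving \<open>x\<close> strictly between two zeros.\<close>

lemma admissible_positive_ray:
  assumes \<gamma>: "0 < \<gamma>" "\<gamma> \<le> 1" and adm: "admissible \<gamma> c \<phi>"
    and z: "\<phi> z = 0" "z < x" "0 < \<phi> x"
  obtains a where "z \<le> a" "a < x" "\<phi> a = 0" "\<And>y. a < y \<Longrightarrow> 0 < \<phi> y"
proof -
  note D = admissibleD[OF \<gamma> adm]
  have cont: "continuous_on {z..x} \<phi>" using D(1) by (rule continuous_on_subset) simp
  have "compact ({z..x} \<inter> \<phi> -` {0})"
    by (rule compact_Int_closed[OF compact_Icc])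
      (use continuous_closed_vimage[of "{0}" \<phi>] D(1) in \<open>auto simp: continuous_on_eq_continuous_within\<close>)
  moreover have "z \<in> {z..x} \<inter> \<phi> -` {0}" using z by simp
  ultimately obtain a where a: "a \<in> {z..x} \<inter> \<phi> -` {0}" "\<And>y. y \<in> {z..x} \<inter> \<phi> -` {0} \<Longrightarrow> y \<le> a"
    using compact_attains_sup by (metis empty_iff)
  have ax: "a < x" using a(1) z by (auto simp: order_le_less)
  have "0 < \<phi> y" if y: "a < y" for y
  proof (rule ccontr)
    assume "\<not> 0 < \<phi> y"
    then have y0: "\<phi> y = 0" using D(2)[of y] by simp
    then have "x < y" using a(2)[of y] a(1) y by force
    then have "\<phi> x = 0" using admissible_zero_between[OF \<gamma> adm ax _ _ y0] a(1) by simp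
    then show False using z by simp
  qed
  then show ?thesis using a(1) ax by (intro that[of a]) auto
qed

text \<open>The point is the sign of phi', which removes the absolute value in the free boundary
  condition. The flux is strictly increasing, so phi' \<le> 0 at one point would make phi' negative
  all the way back to \<open>a\<close>, and phi, starting from 0, would become negative. Finally
  phi' tends to 0, being the ratio with limit sqrt 2 times phi^(\<gamma>/2).\<close>

lemma admissible_half_profile:
  assumes \<gamma>: "0 < \<gamma>" "\<gamma> \<le> 1" and adm: "admissible \<gamma> c \<phi>"
    and zero: "\<phi> a = 0" and pos: "\<And>x. a < x \<Longrightarrow> 0 < \<phi> x"
  shows "half_profile \<gamma> c (\<lambda>x. \<phi> (x + a)) (\<lambda>x. deriv \<phi> (x + a))"
proof -
  note D = admissibleD[OF \<gamma> adm]
  have der: "((\<lambda>x. \<phi> (x + a)) has_real_derivative deriv \<phi> (x + a)) (at x)"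
    "((\<lambda>x. deriv \<phi> (x + a)) has_real_derivative \<gamma> * \<phi> (x + a) powr (\<gamma> - 1) - c * deriv \<phi> (x + a)) (at x)"
    if "0 < x" for x
    using D(5,6)[OF pos[of "x + a"]] that by (simp_all add: DERIV_shift)
  have "isCont \<phi> a" using D(1) by (simp add: continuous_on_eq_continuous_within)
  then have "(\<phi> \<longlongrightarrow> 0) (at_right a)"
    using zero by (auto simp: isCont_def intro: tendsto_within_subset)
  then have lim: "((\<lambda>x. \<phi> (x + a)) \<longlongrightarrow> 0) (at_right 0)"
    by (simp add: filterlim_at_right_to_0[of _ _ a])
  have deriv_pos: "0 < deriv \<phi> x" if x: "a < x" for x
  proof (rule ccontr)
    assume neg: "\<not> 0 < deriv \<phi> x"
    have "\<phi> x < \<phi> a"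
    proof (rule DERIV_neg_imp_decreasing_open[OF x])
      fix y assume y: "a < y" "y < x"
      have "exp (c * y) * deriv \<phi> y < exp (c * x) * deriv \<phi> x"
      proof (rule DERIV_pos_imp_increasing[OF y(2)])
        fix s assume "y \<le> s" "s \<le> x"
        then have s: "0 < \<phi> s" using pos y by simp
        have "((\<lambda>x. exp (c * x) * deriv \<phi> x) has_real_derivative
            exp (c * s) * (\<gamma> * \<phi> s powr (\<gamma> - 1))) (at s)"
          using D(6)[OF s] by (auto intro!: derivative_eq_intros simp: algebra_simps)
        moreover have "0 < exp (c * s) * (\<gamma> * \<phi> s powr (\<gamma> - 1))" using \<gamma> s by simp
        ultimately show "\<exists>d. ((\<lambda>x. exp (c * x) * deriv \<phi> x) has_real_derivative d) (at s) \<and> 0 < d"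
          by blast
      qed
      also have "\<dots> \<le> 0" using neg by (simp add: mult_nonneg_nonpos)
      finally have "deriv \<phi> y < 0" by (simp add: mult_less_0_iff)
      then show "\<exists>d. (\<phi> has_real_derivative d) (at y) \<and> d < 0" using D(5)[OF pos[OF y(1)]] by blast
    next
      show "continuous_on {a..x} \<phi>" using D(1) by (rule continuous_on_subset) simp
    qed
    then show False using zero pos[OF x] by simp
  qed
  have "closure {a<..} \<subseteq> closure {y. 0 < \<phi> y}" using pos by (intro closure_mono) auto
  then have "a \<in> frontier {y. 0 < \<phi> y}"
    using zero interior_subset[of "{y. 0 < \<phi> y}"] by (auto simp: frontier_def)
  from D(7)[OF this] have "((\<lambda>x. \<bar>deriv \<phi> x / \<phi> x powr (\<gamma> / 2)\<bar>) \<longlongrightarrow> sqrt 2) (at_right a)"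
    by (rule tendsto_within_subset) (use pos in auto)
  then have "((\<lambda>x. \<bar>deriv \<phi> (x + a) / \<phi> (x + a) powr (\<gamma> / 2)\<bar>) \<longlongrightarrow> sqrt 2) (at_right 0)"
    by (simp only: filterlim_at_right_to_0[of _ _ a])
  then have ratio: "((\<lambda>x. deriv \<phi> (x + a) / \<phi> (x + a) powr (\<gamma> / 2)) \<longlongrightarrow> sqrt 2) (at_right 0)"
    by (rule Lim_transform_eventually)
      (auto intro!: eventually_at_right_0_pos simp: deriv_pos less_imp_le)
  have "((\<lambda>x. \<phi> (x + a) powr (\<gamma> / 2)) \<longlongrightarrow> 0 powr (\<gamma> / 2)) (at_right 0)"
    using \<gamma> D(2) by (intro tendsto_powr' lim tendsto_const) auto
  from tendsto_mult[OF ratio this]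
  have "((\<lambda>x. deriv \<phi> (x + a) / \<phi> (x + a) powr (\<gamma> / 2) * \<phi> (x + a) powr (\<gamma> / 2)) \<longlongrightarrow> 0) (at_right 0)"
    by simp
  then have "((\<lambda>x. deriv \<phi> (x + a)) \<longlongrightarrow> 0) (at_right 0)"
  proof (rule Lim_transform_eventually, intro eventually_at_right_0_pos)
    fix x :: real assume "0 < x"
    then have "0 < \<phi> (x + a)" using pos by simp
    then show "deriv \<phi> (x + a) / \<phi> (x + a) powr (\<gamma> / 2) * \<phi> (x + a) powr (\<gamma> / 2) = deriv \<phi> (x + a)"
      by simp
  qed
  then show ?thesis
    using pos der lim ratio by (simp add: half_profile_def source_solution_def)
qed

lemma admissible_eq_on_right_ray:
  assumes \<gamma>: "0 < \<gamma>" "\<gamma> \<le> 1" and adm: "admissible \<gamma> c \<phi>"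
    and zero: "\<phi> a = 0" and pos: "\<And>x. a < x \<Longrightarrow> 0 < \<phi> x"
    and p: "half_profile \<gamma> c f f'" and x: "a < x"
  shows "\<phi> x = f (x - a)"
  using half_profile_unique[OF \<gamma> admissible_half_profile[OF \<gamma> adm zero pos] p, of "x - a"] x by simp

text \<open>With C = \<open>c_beta \<gamma>\<close>, the equation needs C^(2-\<gamma>) beta (beta-1)
  = \<gamma> and the boundary condition needs C^(1-\<gamma>/2) beta = sqrt 2. Both follow from
  C^(2-\<gamma>) = 2/beta^2. Uniqueness then turns this example into the formula for c = 0.\<close>

lemma half_profile_zero_speed:
  assumes \<gamma>: "0 < \<gamma>" "\<gamma> \<le> 1"
  shows "half_profile \<gamma> 0 (\<lambda>x. c_beta \<gamma> * x powr beta \<gamma>)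
    (\<lambda>x. c_beta \<gamma> * beta \<gamma> * x powr (beta \<gamma> - 1))"
proof -
  let ?b = "beta \<gamma>" and ?C = "c_beta \<gamma>"
  note b = beta_facts[OF \<gamma>]
  have C: "0 < ?C" by (rule c_beta_pos[OF \<gamma>])
  have C_powr: "?C powr a = (2 / ?b\<^sup>2) powr (?b / 2 * a)" for a
    by (simp add: c_beta_def powr_powr)
  have "?C powr (\<gamma> - 1) * ?C powr (2 - \<gamma>) = ?C"
    using C by (simp flip: powr_add)
  moreover have "?C powr (2 - \<gamma>) = 2 / ?b\<^sup>2"
  proof -
    have "?b / 2 * (2 - \<gamma>) = 1" using \<gamma> by (simp add: beta_def)
    then show ?thesis using b(1) by (simp only: C_powr) simp
  qed
  ultimately have "?C = ?C powr (\<gamma> - 1) * (2 / ?b\<^sup>2)" by simp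
  moreover have "2 / ?b\<^sup>2 * (?b * (?b - 1)) = \<gamma>"
  proof -
    have "2 / ?b\<^sup>2 * (?b * (?b - 1)) = (2 * ?b - 2) / ?b"
      using b(1) by (simp add: power2_eq_square field_simps)
    also have "\<dots> = \<gamma>" unfolding b(4)[symmetric] using b(1) by simp
    finally show ?thesis .
  qed
  ultimately have coeff: "?C * ?b * (?b - 1) = \<gamma> * ?C powr (\<gamma> - 1)"
    by (metis mult.assoc mult.commute)
  have "?C powr (1 - \<gamma> / 2) * ?b = sqrt 2"
  proof -
    have "?b / 2 * (1 - \<gamma> / 2) = 1 / 2" using \<gamma> by (simp add: beta_def field_simps)
    then have "?C powr (1 - \<gamma> / 2) = sqrt (2 / ?b\<^sup>2)"
      by (simp only: C_powr) (simp add: powr_half_sqrt)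
    then show ?thesis using b(1) by (simp add: real_sqrt_divide)
  qed
  then have ratio_coeff: "?C * ?b / ?C powr (\<gamma> / 2) = sqrt 2"
    using C by (simp add: powr_diff)
  have "?C * ?b * x powr (?b - 1) / (?C * x powr ?b) powr (\<gamma> / 2) = sqrt 2" if x: "0 < x" for x
  proof -
    have e: "?b * (\<gamma> / 2) = ?b - 1" using b(4) by simp
    have "(?C * x powr ?b) powr (\<gamma> / 2) = ?C powr (\<gamma> / 2) * x powr (?b * (\<gamma> / 2))"
      using C by (simp add: powr_mult powr_powr)
    then have "(?C * x powr ?b) powr (\<gamma> / 2) = ?C powr (\<gamma> / 2) * x powr (?b - 1)"
      unfolding e .
    then show ?thesis using ratio_coeff x by simp
  qed
  then have ratio: "((\<lambda>x. ?C * ?b * x powr (?b - 1) / (?C * x powr ?b) powr (\<gamma> / 2)) \<longlongrightarrow> sqrt 2) (at_right 0)"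
    by (intro Lim_transform_eventually[OF tendsto_const]) (auto intro!: eventually_at_right_0_pos)
  have der2: "((\<lambda>x. ?C * ?b * x powr (?b - 1)) has_real_derivative \<gamma> * (?C * x powr ?b) powr (\<gamma> - 1)) (at x)"
    if x: "0 < x" for x
  proof (rule has_real_derivative_powr_const[OF x])
    have "(?C * x powr ?b) powr (\<gamma> - 1) = ?C powr (\<gamma> - 1) * x powr (?b - 2)"
      using C b(3) by (simp add: powr_mult powr_powr)
    then show "\<gamma> * (?C * x powr ?b) powr (\<gamma> - 1) = ?C * ?b * ((?b - 1) * x powr (?b - 1 - 1))"
      using coeff by (simp flip: mult.assoc)
  qed
  have der: "((\<lambda>x. ?C * x powr ?b) has_real_derivative ?C * ?b * x powr (?b - 1)) (at x)" if "0 < x" for x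
    by (rule has_real_derivative_powr_const[OF that]) simp
  have "((\<lambda>x. ?C * x powr ?b) \<longlongrightarrow> 0) (at_right 0)" "((\<lambda>x. ?C * ?b * x powr (?b - 1)) \<longlongrightarrow> 0) (at_right 0)"
    using b(1) by (auto intro!: tendsto_mult_right_zero tendsto_powr_at_right_0)
  then show ?thesis
    using C der der2 ratio by (auto simp: half_profile_def source_solution_def)
qed

text \<open>Everything about a single right-hand profile is collected here for arbitrary speed, so
  that the left-hand profile can reuse it with speed -c after reflection.\<close>

lemma half_profile_extension_properties:
  fixes f :: "real \<Rightarrow> real"
  assumes \<gamma>: "0 < \<gamma>" "\<gamma> \<le> 1" and p: "half_profile \<gamma> c f f'"
  defines "\<phi> \<equiv> \<lambda>x. if x \<le> 0 then 0 else f x"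
  shows "\<forall>x>0. \<exists>d>0. (\<phi> has_real_derivative d) (at x)"
    and "\<And>\<psi>. admissible \<gamma> c \<psi> \<Longrightarrow> \<forall>x\<le>0. \<psi> x = 0 \<Longrightarrow>
          \<forall>x>0. \<exists>d>0. (\<psi> has_real_derivative d) (at x) \<Longrightarrow> \<psi> = \<phi>"
    and "filterlim \<phi> at_top at_top"
    and "c = 0 \<Longrightarrow> \<phi> x = c_beta \<gamma> * (max x 0) powr beta \<gamma>"
    and "c > 0 \<Longrightarrow> \<phi> \<sim>[at_top] (\<lambda>x. (2 * \<gamma> / (beta \<gamma> * c) * x) powr (beta \<gamma> / 2))"
    and "c < 0 \<Longrightarrow> \<exists>k>0. \<phi> \<sim>[at_top] (\<lambda>x. k * exp (- c * x))"
proof -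
  have ev: "\<forall>\<^sub>F x in at_top. f x = \<phi> x"
    using eventually_gt_at_top[of 0] by eventually_elim (simp add: \<phi>_def)
  have f_iff: "f \<sim>[at_top] h \<longleftrightarrow> \<phi> \<sim>[at_top] h" for h
    by (rule asymp_equiv_cong[OF ev]) simp
  show "\<forall>x>0. \<exists>d>0. (\<phi> has_real_derivative d) (at x)"
  proof (intro allI impI exI conjI)
    fix x :: real assume x: "0 < x"
    show "0 < f' x" by (rule half_profile_deriv_pos[OF \<gamma> p x])
    show "(\<phi> has_real_derivative f' x) (at x)"
      by (rule has_real_derivative_cong_at_right[OF half_profileD(2)[OF p x] _ x]) (simp add: \<phi>_def)
  qed
  show "filterlim \<phi> at_top at_top"
    using half_profile_at_top[OF \<gamma> p] filterlim_cong[OF refl refl ev] by blast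
  show "\<phi> \<sim>[at_top] (\<lambda>x. (2 * \<gamma> / (beta \<gamma> * c) * x) powr (beta \<gamma> / 2))" if "c > 0"
    using half_profile_asymp_powr[OF \<gamma> p that] by (simp only: f_iff)
  show "\<exists>k>0. \<phi> \<sim>[at_top] (\<lambda>x. k * exp (- c * x))" if "c < 0"
    using half_profile_asymp_exp[OF \<gamma> p that] by (simp only: f_iff)
  \<comment> \<open>For x \<le> 0 both sides vanish, since \<open>0 powr beta \<gamma>\<close> is
    0.\<close>
  show "\<phi> x = c_beta \<gamma> * (max x 0) powr beta \<gamma>" if "c = 0"
    using half_profile_unique[OF \<gamma> _ half_profile_zero_speed[OF \<gamma>], of f f' x] p that
    by (auto simp: \<phi>_def max_def)
  fix \<psi> assume adm: "admissible \<gamma> c \<psi>" and zero: "\<forall>x\<le>0. \<psi> x = 0"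
    and inc: "\<forall>x>0. \<exists>d>0. (\<psi> has_real_derivative d) (at x)"
  have pos: "0 < \<psi> x" if x: "0 < x" for x
  proof -
    have "\<psi> 0 < \<psi> x"
    proof (rule DERIV_pos_imp_increasing_open[OF x])
      show "continuous_on {0..x} \<psi>"
        using admissibleD(1)[OF \<gamma> adm] by (rule continuous_on_subset) simp
    qed (use inc in blast)
    then show ?thesis using zero by simp
  qed
  show "\<psi> = \<phi>"
  proof
    show "\<psi> x = \<phi> x" for x
      using admissible_eq_on_right_ray[OF \<gamma> adm _ pos p, of 0 x] zero by (cases "x \<le> 0") (auto simp: \<phi>_def)
  qed
qed

section \<open>Left rays by reflection, and the classification\<close>

lemma admissible_eq_on_left_ray:
  assumes \<gamma>: "0 < \<gamma>" "\<gamma> \<le> 1" and adm: "admissible \<gamma> c \<phi>"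
    and zero: "\<phi> a = 0" and pos: "\<And>x. x < a \<Longrightarrow> 0 < \<phi> x"
    and p: "half_profile \<gamma> (- c) f f'" and x: "x < a"
  shows "\<phi> x = f (a - x)"
  using admissible_eq_on_right_ray[OF \<gamma> admissible_reflect[OF \<gamma> adm], of "- a" f f' "- x"] zero pos p x
  by simp

lemma admissible_negative_ray:
  assumes \<gamma>: "0 < \<gamma>" "\<gamma> \<le> 1" and adm: "admissible \<gamma> c \<phi>"
    and z: "\<phi> z = 0" "x < z" "0 < \<phi> x"
  obtains a where "a \<le> z" "x < a" "\<phi> a = 0" "\<And>y. y < a \<Longrightarrow> 0 < \<phi> y"
proof -
  obtain a where a: "- z \<le> a" "a < - x" "\<phi> (- a) = 0" "\<And>y. a < y \<Longrightarrow> 0 < \<phi> (- y)"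
    by (rule admissible_positive_ray[OF \<gamma> admissible_reflect[OF \<gamma> adm], of "- z" "- x"]) (use z in auto)
  show ?thesis
  proof (rule that[of "- a"])
    show "0 < \<phi> y" if "y < - a" for y using a(4)[of "- y"] that by simp
  qed (use a in auto)
qed

text \<open>Seen from a zero, a positive value on either side forces a whole ray of positivity on
  that side, on which uniqueness identifies the profile. Between the starting points of two such
  rays the no-bump property leaves only 0.\<close>

lemma admissible_classification:
  assumes \<gamma>: "0 < \<gamma>" "\<gamma> \<le> 1" and adm: "admissible \<gamma> c \<psi>"
    and f: "half_profile \<gamma> c f f'" and g: "half_profile \<gamma> (- c) g g'"
  defines "\<phi>p \<equiv> \<lambda>x. if x \<le> 0 then 0 else f x" and "\<phi>m \<equiv> \<lambda>x. if - x \<le> 0 then 0 else g (- x)"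
  shows "\<exists>a b :: real. a \<in> {0, 1} \<and> b \<in> {0, 1} \<and> a\<^sup>2 + b\<^sup>2 \<noteq> 0 \<and>
          (\<exists>xp xm. xm \<le> xp \<and> (\<forall>x. \<psi> x = a * \<phi>p (x - xp) + b * \<phi>m (x - xm)))"
proof -
  note D = admissibleD[OF \<gamma> adm]
  obtain p z where pz: "0 < \<psi> p" "\<psi> z = 0" using D(3,4) by blast
  show ?thesis
  proof (cases "\<exists>x>z. 0 < \<psi> x")
    case True
    then obtain x0 where "z < x0" "0 < \<psi> x0" by blast
    then obtain r where r: "z \<le> r" "\<psi> r = 0" "\<And>y. r < y \<Longrightarrow> 0 < \<psi> y"
      using admissible_positive_ray[OF \<gamma> adm pz(2)] by metis
    have right: "\<psi> x = f (x - r)" if "r < x" for x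
      using admissible_eq_on_right_ray[OF \<gamma> adm r(2,3) f that] .
    show ?thesis
    proof (cases "\<exists>x<r. 0 < \<psi> x")
      case True
      then obtain x1 where "x1 < r" "0 < \<psi> x1" by blast
      then obtain l where l: "l \<le> r" "\<psi> l = 0" "\<And>y. y < l \<Longrightarrow> 0 < \<psi> y"
        using admissible_negative_ray[OF \<gamma> adm r(2)] by metis
      have left: "\<psi> x = g (l - x)" if "x < l" for x
        using admissible_eq_on_left_ray[OF \<gamma> adm l(2,3) g that] .
      have mid: "\<psi> x = 0" if "l \<le> x" "x \<le> r" for x
        using admissible_zero_between[OF \<gamma> adm _ _ l(2) r(2), of x] l(2) r(2) that by (cases "x = l \<or> x = r") auto
      have "\<psi> x = 1 * \<phi>p (x - r) + 1 * \<phi>m (x - l)" for x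
        using left[of x] right[of x] mid[of x] l(1) by (auto simp: \<phi>p_def \<phi>m_def not_le)
      then show ?thesis using l(1) by (intro exI[of _ 1] conjI exI[of _ r] exI[of _ l]) auto
    next
      case False
      then have left: "\<psi> x = 0" if "x \<le> r" for x
        using that r(2) D(2)[of x] by (cases "x = r") (auto simp: order_le_less)
      \<comment> \<open>The shift of the absent branch is free; taking it equal to the other one
        satisfies \<open>xm \<le> xp\<close>.\<close>
      have "\<psi> x = 1 * \<phi>p (x - r) + 0 * \<phi>m (x - r)" for x
        using left[of x] right[of x] by (auto simp: \<phi>p_def)
      then show ?thesis by (intro exI[of _ 1] exI[of _ 0] conjI exI[of _ r]) auto
    qed
  next
    case False
    then have "p < z" using pz by (metis less_irrefl linorder_neqE_linordered_idom)
    then obtain l where l: "l \<le> z" "\<psi> l = 0" "\<And>y. y < l \<Longrightarrow> 0 < \<psi> y"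
      using admissible_negative_ray[OF \<gamma> adm pz(2) _ pz(1)] by metis
    have left: "\<psi> x = g (l - x)" if "x < l" for x
      using admissible_eq_on_left_ray[OF \<gamma> adm l(2,3) g that] .
    have right: "\<psi> x = 0" if "l \<le> x" for x
    proof (cases "x < z")
      case True
      then show ?thesis
        using admissible_zero_between[OF \<gamma> adm _ _ l(2) pz(2), of x] l(2) that by (cases "x = l") auto
    next
      case False
      then show ?thesis
        using \<open>\<not> (\<exists>x>z. 0 < \<psi> x)\<close> pz(2) D(2)[of x] by (cases "x = z") (auto simp: order_le_less)
    qed
    have "\<psi> x = 0 * \<phi>p (x - l) + 1 * \<phi>m (x - l)" for x
      using left[of x] right[of x] by (auto simp: \<phi>m_def not_le)
    then show ?thesis by (intro exI[of _ 0] exI[of _ 1] conjI exI[of _ l]) auto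
  qed
qed

theorem theorem7p2:
  fixes \<gamma> c :: real
  assumes "0 < \<gamma>" and "\<gamma> \<le> 1"
  shows "\<exists>\<phi>p \<phi>m :: real \<Rightarrow> real.
    admissible \<gamma> c \<phi>p \<and> admissible \<gamma> c \<phi>m \<and>
    \<comment> \<open>(a)\<close>
    (\<forall>x\<le>0. \<phi>p x = 0) \<and>
    (\<forall>x>0. \<exists>d>0. (\<phi>p has_real_derivative d) (at x)) \<and>
    (\<forall>\<psi>. admissible \<gamma> c \<psi> \<and> (\<forall>x\<le>0. \<psi> x = 0) \<and>
          (\<forall>x>0. \<exists>d>0. (\<psi> has_real_derivative d) (at x)) \<longrightarrow> \<psi> = \<phi>p) \<and>
    filterlim \<phi>p at_top at_top \<and>
    (c = 0 \<longrightarrow> (\<forall>x. \<phi>p x = c_beta \<gamma> * (max x 0) powr beta \<gamma>)) \<and>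
    (c > 0 \<longrightarrow> \<phi>p \<sim>[at_top] (\<lambda>x. (2 * \<gamma> / (beta \<gamma> * c) * x) powr (beta \<gamma> / 2))) \<and>
    (c < 0 \<longrightarrow> (\<exists>k>0. \<phi>p \<sim>[at_top] (\<lambda>x. k * exp (- c * x)))) \<and>
    \<comment> \<open>(b)\<close>
    (\<forall>x\<ge>0. \<phi>m x = 0) \<and>
    (\<forall>x<0. \<exists>d<0. (\<phi>m has_real_derivative d) (at x)) \<and>
    (\<forall>\<psi>. admissible \<gamma> c \<psi> \<and> (\<forall>x\<ge>0. \<psi> x = 0) \<and>
          (\<forall>x<0. \<exists>d<0. (\<psi> has_real_derivative d) (at x)) \<longrightarrow> \<psi> = \<phi>m) \<and>
    filterlim \<phi>m at_top at_bot \<and>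
    (c = 0 \<longrightarrow> (\<forall>x. \<phi>m x = c_beta \<gamma> * (max (- x) 0) powr beta \<gamma>)) \<and>
    (c > 0 \<longrightarrow> (\<exists>k>0. \<phi>m \<sim>[at_bot] (\<lambda>x. k * exp (- c * x)))) \<and>
    (c < 0 \<longrightarrow> \<phi>m \<sim>[at_bot] (\<lambda>x. (2 * \<gamma> / (beta \<gamma> * \<bar>c\<bar>) * \<bar>x\<bar>) powr (beta \<gamma> / 2))) \<and>
    \<comment> \<open>classification\<close>
    (\<forall>\<psi>. admissible \<gamma> c \<psi> \<longrightarrow>
       (\<exists>a b :: real. a \<in> {0, 1} \<and> b \<in> {0, 1} \<and> a\<^sup>2 + b\<^sup>2 \<noteq> 0 \<and>
          (\<exists>xp xm. xm \<le> xp \<and> (\<forall>x. \<psi> x = a * \<phi>p (x - xp) + b * \<phi>m (x - xm)))))"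
proof -
  note \<gamma> = assms
  obtain f f' where f: "half_profile \<gamma> c f f'" using half_profile_exists[OF \<gamma>] by blast
  \<comment> \<open>The left-hand profile for speed c will be the mirror image of this right-hand
    one for speed -c, so the cases c > 0 and c < 0 trade places.\<close>
  obtain g g' where g: "half_profile \<gamma> (- c) g g'" using half_profile_exists[OF \<gamma>] by blast
  define \<phi>p where "\<phi>p = (\<lambda>x. if x \<le> 0 then 0 else f x)"
  define \<eta> where "\<eta> = (\<lambda>x. if x \<le> 0 then 0 else g x)"
  define \<phi>m where "\<phi>m = (\<lambda>x. \<eta> (- x))"
  note P = half_profile_extension_properties[OF \<gamma> f, folded \<phi>p_def]
  note Q = half_profile_extension_properties[OF \<gamma> g, folded \<eta>_def]
  have uminus_bot: "filterlim uminus at_top (at_bot :: real filter)"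
    by (rule filterlim_uminus_at_top_at_bot)
  have adm_p: "admissible \<gamma> c \<phi>p"
    unfolding \<phi>p_def by (rule half_profile_admissible[OF \<gamma> f])
  have adm_m: "admissible \<gamma> c \<phi>m"
    using admissible_reflect[OF \<gamma> half_profile_admissible[OF \<gamma> g]] by (simp add: \<phi>m_def \<eta>_def)
  have zeros: "\<forall>x\<le>0. \<phi>p x = 0" "\<forall>x\<ge>0. \<phi>m x = 0"
    by (auto simp: \<phi>p_def \<phi>m_def \<eta>_def)
  have dec: "\<forall>x<0. \<exists>d<0. (\<phi>m has_real_derivative d) (at x)"
  proof (intro allI impI)
    fix x :: real assume "x < 0"
    then obtain d where "0 < d" "(\<eta> has_real_derivative d) (at (- x))"
      using Q(1) by (metis neg_0_less_iff_less)
    then show "\<exists>d<0. (\<phi>m has_real_derivative d) (at x)"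
      unfolding \<phi>m_def DERIV_mirror by (intro exI[of _ "- d"]) simp
  qed
  have "\<psi> = \<phi>m" if adm: "admissible \<gamma> c \<psi>" and zero: "\<forall>x\<ge>0. \<psi> x = 0"
    and dec: "\<forall>x<0. \<exists>d<0. (\<psi> has_real_derivative d) (at x)" for \<psi>
  proof -
    have "(\<lambda>x. \<psi> (- x)) = \<eta>"
    proof (rule Q(2)[OF admissible_reflect[OF \<gamma> adm]])
      show "\<forall>x\<le>0. \<psi> (- x) = 0" using zero by simp
      show "\<forall>x>0. \<exists>d>0. ((\<lambda>x. \<psi> (- x)) has_real_derivative d) (at x)"
      proof (intro allI impI)
        fix x :: real assume "0 < x"
        then obtain d where "d < 0" "(\<psi> has_real_derivative d) (at (- x))"
          using dec by (metis neg_less_0_iff_less)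
        then show "\<exists>d>0. ((\<lambda>x. \<psi> (- x)) has_real_derivative d) (at x)"
          unfolding DERIV_mirror by (intro exI[of _ "- d"]) simp
      qed
    qed
    then show ?thesis unfolding \<phi>m_def by (metis minus_minus)
  qed
  then have unique_m: "\<forall>\<psi>. admissible \<gamma> c \<psi> \<and> (\<forall>x\<ge>0. \<psi> x = 0) \<and>
          (\<forall>x<0. \<exists>d<0. (\<psi> has_real_derivative d) (at x)) \<longrightarrow> \<psi> = \<phi>m"
    by blast
  have unique_p: "\<forall>\<psi>. admissible \<gamma> c \<psi> \<and> (\<forall>x\<le>0. \<psi> x = 0) \<and>
          (\<forall>x>0. \<exists>d>0. (\<psi> has_real_derivative d) (at x)) \<longrightarrow> \<psi> = \<phi>p"
    using P(2) by blast
  have lim_m: "filterlim \<phi>m at_top at_bot"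
    unfolding \<phi>m_def by (rule filterlim_compose[OF Q(3) uminus_bot])
  have zero_m: "c = 0 \<longrightarrow> (\<forall>x. \<phi>m x = c_beta \<gamma> * (max (- x) 0) powr beta \<gamma>)"
    using Q(4) by (simp add: \<phi>m_def \<eta>_def)
  have zero_p: "c = 0 \<longrightarrow> (\<forall>x. \<phi>p x = c_beta \<gamma> * (max x 0) powr beta \<gamma>)"
    using P(4) by (simp add: \<phi>p_def)
  have exp_m: "\<exists>k>0. \<phi>m \<sim>[at_bot] (\<lambda>x. k * exp (- c * x))" if c: "c > 0"
  proof -
    obtain k where k: "0 < k" "\<eta> \<sim>[at_top] (\<lambda>x. k * exp (- (- c) * x))"
      using Q(6) c by auto
    from asymp_equiv_compose'[OF k(2) uminus_bot] k(1) show ?thesis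
      by (auto simp: \<phi>m_def)
  qed
  have powr_m: "\<phi>m \<sim>[at_bot] (\<lambda>x. (2 * \<gamma> / (beta \<gamma> * \<bar>c\<bar>) * \<bar>x\<bar>) powr (beta \<gamma> / 2))" if c: "c < 0"
  proof -
    have neg: "\<phi>m \<sim>[at_bot] (\<lambda>x. (2 * \<gamma> / (beta \<gamma> * - c) * - x) powr (beta \<gamma> / 2))"
      unfolding \<phi>m_def by (rule asymp_equiv_compose'[OF Q(5) uminus_bot]) (use c in simp)
    \<comment> \<open>The absolute values match only where x \<le> 0, which holds eventually at
      minus infinity.\<close>
    have ev: "\<forall>\<^sub>F x in at_bot. (2 * \<gamma> / (beta \<gamma> * - c) * - x) powr (beta \<gamma> / 2) =
        (2 * \<gamma> / (beta \<gamma> * \<bar>c\<bar>) * \<bar>x\<bar>) powr (beta \<gamma> / 2)"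
      using eventually_le_at_bot[of 0] by eventually_elim (use c in simp)
    show ?thesis
      by (rule iffD1[OF asymp_equiv_cong[OF _ ev] neg]) simp
  qed
  have classification: "\<forall>\<psi>. admissible \<gamma> c \<psi> \<longrightarrow>
       (\<exists>a b :: real. a \<in> {0, 1} \<and> b \<in> {0, 1} \<and> a\<^sup>2 + b\<^sup>2 \<noteq> 0 \<and>
          (\<exists>xp xm. xm \<le> xp \<and> (\<forall>x. \<psi> x = a * \<phi>p (x - xp) + b * \<phi>m (x - xm))))"
    using admissible_classification[OF \<gamma> _ f g] unfolding \<phi>m_def \<eta>_def \<phi>p_def by blast
  show ?thesis
    by (rule exI[of _ \<phi>p], rule exI[of _ \<phi>m], intro conjI)
      (fact adm_p adm_m zeros P(1,3) dec unique_p unique_m lim_m zero_p zero_m classification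
        | rule impI, rule P(5,6) exp_m powr_m, assumption)+
qed

end
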